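(* The Formula-Pair problem (with formula over $2m$ variables and sets of size $n$) can be solved in time $O(n^2m/\log^2 n+n^2/\log n)$ in the Word-RAM model.
   Context: Formula-Pair: given a deMorgan formula $F(x_1,\dots,x_m,y_1,\dots,y_m)$ (leaves labelled by variables or negated variables, internal AND/OR gates) in which every variable appears exactly once, and two sets $A,B\subseteq\{0,1\}^m$ of size $n$, decide whether there exist $a\in A,b\in B$ with $F(a_1,\dots,a_m,b_1,\dots,b_m)=\mathsf{true}$. Word-RAM: words of $\Theta(\log n)$ bits with unit-time standard operations. *)

theory Defs
  imports Complex_Main
begin

section \<open>DeMorgan formulas and the Formula-Pair problem\<close>

text \<open>Vectors in $\{0,1\}^m$ are Boolean lists of length $m$; coordinates are counted from 0,
  so \<open>X i\<close> and \<open>Y i\<close> (for \<open>i < m\<close>) stand for $x_{i+1}$ and $y_{i+1}$.\<close>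

datatype var = X nat | Y nat

datatype formula =
    Pos var
  | Neg var
  | And formula formula
  | Or formula formula

fun eval_var :: "bool list \<Rightarrow> bool list \<Rightarrow> var \<Rightarrow> bool" where
  "eval_var a b (X i) = a ! i"
| "eval_var a b (Y i) = b ! i"

fun eval_formula :: "bool list \<Rightarrow> bool list \<Rightarrow> formula \<Rightarrow> bool" where
  "eval_formula a b (Pos v) = eval_var a b v"
| "eval_formula a b (Neg v) = (\<not> eval_var a b v)"
| "eval_formula a b (And f g) = (eval_formula a b f \<and> eval_formula a b g)"
| "eval_formula a b (Or f g) = (eval_formula a b f \<or> eval_formula a b g)"

fun leaf_vars :: "formula \<Rightarrow> var list" where
  "leaf_vars (Pos v) = [v]"
| "leaf_vars (Neg v) = [v]"
| "leaf_vars (And f g) = leaf_vars f @ leaf_vars g"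
| "leaf_vars (Or f g) = leaf_vars f @ leaf_vars g"

definition each_var_once :: "nat \<Rightarrow> formula \<Rightarrow> bool" where
  "each_var_once m F \<longleftrightarrow>
     distinct (leaf_vars F) \<and> set (leaf_vars F) = X ` {..<m} \<union> Y ` {..<m}"

definition formula_pair :: "formula \<Rightarrow> bool list set \<Rightarrow> bool list set \<Rightarrow> bool" where
  "formula_pair F A B \<longleftrightarrow> (\<exists>a\<in>A. \<exists>b\<in>B. eval_formula a b F)"

text \<open>A machine receives the sets $A$ and $B$ as repetition-free lists in arbitrary order.\<close>

definition formula_pair_instance ::
  "nat \<Rightarrow> nat \<Rightarrow> formula \<Rightarrow> bool list list \<Rightarrow> bool list list \<Rightarrow> bool" where
  "formula_pair_instance n m F as bs \<longleftrightarrow>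
     each_var_once m F \<and>
     distinct as \<and> length as = n \<and> (\<forall>a\<in>set as. length a = m) \<and>
     distinct bs \<and> length bs = n \<and> (\<forall>b\<in>set bs. length b = m)"

section \<open>Word-RAM\<close>

text \<open>Words of \<open>w\<close> bits are represented by natural numbers below \<open>2 ^ w\<close>.  A program is a
  finite list of instructions and hence uses finitely many registers; apart from these there is
  a memory of \<open>2 ^ w\<close> words, accessed by indirect addressing.\<close>

datatype binop = Add | Sub | Mul | Div | Mod | BitAnd | BitOr | BitXor | Shl | Shr

type_synonym reg = nat

datatype instr =
    Const reg nat
  | Op binop reg reg reg
  | Load reg reg
  | Store reg reg
  | Jump nat
  | JumpEq reg reg nat
  | JumpLess reg reg nat

text \<open>Arithmetic is modulo \<open>2 ^ w\<close>; for words \<open>x\<close> and \<open>y\<close> the truncated subtraction below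
  never truncates.  As usual in HOL, \<open>x div 0 = 0\<close> and \<open>x mod 0 = x\<close>.\<close>

fun binop_word :: "nat \<Rightarrow> binop \<Rightarrow> nat \<Rightarrow> nat \<Rightarrow> nat" where
  "binop_word w Add x y = take_bit w (x + y)"
| "binop_word w Sub x y = take_bit w (x + 2 ^ w - y)"
| "binop_word w Mul x y = take_bit w (x * y)"
| "binop_word w Div x y = x div y"
| "binop_word w Mod x y = x mod y"
| "binop_word w BitAnd x y = and x y"
| "binop_word w BitOr x y = or x y"
| "binop_word w BitXor x y = xor x y"
| "binop_word w Shl x y = take_bit w (push_bit y x)"
| "binop_word w Shr x y = drop_bit y x"

record state =
  pc :: nat
  regs :: "reg \<Rightarrow> nat"
  mem :: "nat \<Rightarrow> nat"

fun exec_instr :: "nat \<Rightarrow> instr \<Rightarrow> state \<Rightarrow> state" where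
  "exec_instr w (Const r k) s =
     s\<lparr>pc := pc s + 1, regs := (regs s)(r := take_bit w k)\<rparr>"
| "exec_instr w (Op f r p q) s =
     s\<lparr>pc := pc s + 1, regs := (regs s)(r := binop_word w f (regs s p) (regs s q))\<rparr>"
| "exec_instr w (Load r p) s =
     s\<lparr>pc := pc s + 1, regs := (regs s)(r := mem s (regs s p))\<rparr>"
| "exec_instr w (Store p r) s =
     s\<lparr>pc := pc s + 1, mem := (mem s)(regs s p := regs s r)\<rparr>"
| "exec_instr w (Jump l) s = s\<lparr>pc := l\<rparr>"
| "exec_instr w (JumpEq p q l) s =
     s\<lparr>pc := (if regs s p = regs s q then l else pc s + 1)\<rparr>"
| "exec_instr w (JumpLess p q l) s =
     s\<lparr>pc := (if regs s p < regs s q then l else pc s + 1)\<rparr>"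

text \<open>Control leaving the program halts the machine.\<close>

definition halted :: "instr list \<Rightarrow> state \<Rightarrow> bool" where
  "halted P s \<longleftrightarrow> length P \<le> pc s"

definition step :: "nat \<Rightarrow> instr list \<Rightarrow> state \<Rightarrow> state" where
  "step w P s = (if halted P s then s else exec_instr w (P ! pc s) s)"

definition init_state :: "nat list \<Rightarrow> state" where
  "init_state xs =
     \<lparr>pc = 0, regs = (\<lambda>_. 0), mem = (\<lambda>i. if i < length xs then xs ! i else 0)\<rparr>"

text \<open>The answer is read off register 0.\<close>

definition decides_within :: "nat \<Rightarrow> instr list \<Rightarrow> nat list \<Rightarrow> bool \<Rightarrow> real \<Rightarrow> bool" where
  "decides_within w P xs answer T \<longleftrightarrow>
     (\<exists>t. real t \<le> T \<and>
        halted P ((step w P ^^ t) (init_state xs)) \<and>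
        regs ((step w P ^^ t) (init_state xs)) 0 = (if answer then 1 else 0))"

section \<open>Input encoding\<close>

text \<open>The input consists of \<open>n\<close> and \<open>m\<close>, the formula in postfix notation with one word per
  node, and the vectors of $A$ and of $B$ with one word per coordinate.\<close>

fun encode_var :: "var \<Rightarrow> nat" where
  "encode_var (X i) = 2 * i"
| "encode_var (Y i) = 2 * i + 1"

fun encode_formula :: "formula \<Rightarrow> nat list" where
  "encode_formula (Pos v) = [2 * encode_var v + 2]"
| "encode_formula (Neg v) = [2 * encode_var v + 3]"
| "encode_formula (And f g) = encode_formula f @ encode_formula g @ [0]"
| "encode_formula (Or f g) = encode_formula f @ encode_formula g @ [1]"

definition encode_vectors :: "bool list list \<Rightarrow> nat list" where
  "encode_vectors vs = map of_bool (concat vs)"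

definition encode_instance ::
  "nat \<Rightarrow> nat \<Rightarrow> formula \<Rightarrow> bool list list \<Rightarrow> bool list list \<Rightarrow> nat list" where
  "encode_instance n m F as bs =
     [n, m] @ encode_formula F @ encode_vectors as @ encode_vectors bs"

text \<open>Words have $\Theta(\log n)$ bits: at most \<open>\<kappa> * log 2 n\<close>, and enough that the memory can
  hold the input together with working space for a constant factor \<open>K\<close>.  The latter gives
  \<open>w \<ge> log 2 n\<close> whenever \<open>K \<ge> 1\<close>.\<close>

definition admissible_word_size :: "real \<Rightarrow> nat \<Rightarrow> nat \<Rightarrow> nat list \<Rightarrow> nat \<Rightarrow> bool" where
  "admissible_word_size \<kappa> K n xs w \<longleftrightarrow>
     real w \<le> \<kappa> * log 2 (real n) \<and> K * length xs \<le> 2 ^ w"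

end

theory Submission
  imports Defs
begin

text \<open>
  Let \<open>L = \<lfloor>log 2 n\<rfloor>\<close>.  The formula tree is cut into \<open>O(m / L)\<close> pieces, each with at most
  \<open>s \<approx> L / 4\<close> leaves labelled by an x-variable and at most one hole, into which the value of another
  piece is plugged.  Once the x-variables of a piece are fixed, what remains is a monotone function
  of its hole, so it is given by its values for hole 0 and hole 1.  For a batch of \<open>L\<close> vectors
  \<open>b\<close>, these values are tabulated as words of \<open>L\<close> bits (one bit per \<open>b\<close>) for all \<open>2 ^ s\<close> assignments to
  the x-variables; this is cheap since \<open>2 ^ s = O(n\<^bsup>1/4\<^esup>)\<close>.  After that, each pair of a vector \<open>a\<close> and a
  batch costs \<open>O(m / L)\<close> word operations, and there are \<open>O(n\<^sup>2 / L)\<close> such pairs.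
\<close>


text \<open>Only X-leaves count towards the size of a piece: once the batch is fixed, a Y-leaf is a
  constant word, while the table ranges over X-assignments. A second hole would double the index
  range, hence a gate where two pieces with holes meet is cut as well; a potential argument keeps
  the number of cuts in O(m / L) all the same. The vectors of a batch may disagree on the value in a
  hole, so no single table entry can be looked up; as negation occurs at leaves only, the two
  entries can be combined bitwise instead. The summand n^2 / log n of the bound is the constant
  overhead per pair of a vector and a batch. The machine computes modulo \<open>2 ^ w\<close>, and
  one program has to serve every admissible \<open>w\<close>. So the algorithm is written over
  natural numbers, with loops and unbounded arrays: \<open>cost\<close> counts the instructions of
  the compiled code, \<open>safe\<close> confines arithmetic and indices to a bound
  \<open>M\<close>, and one simulation theorem transfers everything to the machine once
  \<open>M\<close> is small enough against \<open>2 ^ w\<close>. For the same reason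
  \<open>L\<close> is computed from \<open>n\<close> and not from \<open>w\<close>.\<close>

datatype exp = Lit nat | Var nat | Bin binop exp exp | Inp exp | Ld nat exp

datatype cmd =
    Skip
  | Asg nat exp
  | St nat exp exp
  | Seq cmd cmd (infixr ";;" 60)
  | IfLess exp exp cmd cmd
  | For nat exp cmd

record st =
  vars :: "nat \<Rightarrow> nat"
  arr :: "nat \<Rightarrow> nat \<Rightarrow> nat"

fun nat_op :: "binop \<Rightarrow> nat \<Rightarrow> nat \<Rightarrow> nat" where
  "nat_op Add x y = x + y"
| "nat_op Sub x y = x - y"
| "nat_op Mul x y = x * y"
| "nat_op Div x y = x div y"
| "nat_op Mod x y = x mod y"
| "nat_op BitAnd x y = and x y"
| "nat_op BitOr x y = or x y"
| "nat_op BitXor x y = xor x y"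
| "nat_op Shl x y = x * 2 ^ y"
| "nat_op Shr x y = x div 2 ^ y"

text \<open>Safety rules out that word arithmetic differs from arithmetic on natural numbers.\<close>

fun op_safe :: "nat \<Rightarrow> binop \<Rightarrow> nat \<Rightarrow> nat \<Rightarrow> bool" where
  "op_safe M Add x y = (x + y < M)"
| "op_safe M Sub x y = (y \<le> x \<and> x - y < M)"
| "op_safe M Mul x y = (x * y < M)"
| "op_safe M Shl x y = (x * 2 ^ y < M)"
| "op_safe M _ x y = True"

fun eval :: "nat list \<Rightarrow> exp \<Rightarrow> st \<Rightarrow> nat" where
  "eval xs (Lit k) s = k"
| "eval xs (Var v) s = vars s v"
| "eval xs (Bin f a b) s = nat_op f (eval xs a s) (eval xs b s)"
| "eval xs (Inp e) s = xs ! eval xs e s"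
| "eval xs (Ld a e) s = arr s a (eval xs e s)"

text \<open>\<open>M\<close> bounds literals, array indices and the results of those operations that
  could wrap around, but not the values read from the input or from arrays. The word size enters
  only later, through the assumption of locale \<open>ram\<close>.\<close>

fun safeE :: "nat list \<Rightarrow> nat \<Rightarrow> exp \<Rightarrow> st \<Rightarrow> bool" where
  "safeE xs M (Lit k) s = (k < M)"
| "safeE xs M (Var v) s = True"
| "safeE xs M (Bin f a b) s =
     (safeE xs M a s \<and> safeE xs M b s \<and> op_safe M f (eval xs a s) (eval xs b s))"
| "safeE xs M (Inp e) s = (safeE xs M e s \<and> eval xs e s < length xs)"
| "safeE xs M (Ld a e) s = (safeE xs M e s \<and> eval xs e s < M)"

abbreviation set_var :: "nat \<Rightarrow> nat \<Rightarrow> st \<Rightarrow> st" where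
  "set_var v x s \<equiv> s\<lparr>vars := (vars s)(v := x)\<rparr>"

primrec iter :: "nat \<Rightarrow> (st \<Rightarrow> st) \<Rightarrow> nat \<Rightarrow> st \<Rightarrow> st" where
  "iter v f 0 s = s"
| "iter v f (Suc i) s = f (set_var v i (iter v f i s))"

primrec exec :: "nat list \<Rightarrow> cmd \<Rightarrow> st \<Rightarrow> st" where
  "exec xs Skip s = s"
| "exec xs (Asg v e) s = set_var v (eval xs e s) s"
| "exec xs (St a e1 e2) s =
     s\<lparr>arr := (arr s)(a := (arr s a)(eval xs e1 s := eval xs e2 s))\<rparr>"
| "exec xs (c1 ;; c2) s = exec xs c2 (exec xs c1 s)"
| "exec xs (IfLess a b c1 c2) s =
     (if eval xs a s < eval xs b s then exec xs c1 s else exec xs c2 s)"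
| "exec xs (For v e c) s = iter v (exec xs c) (eval xs e s) s"

primrec safe :: "nat list \<Rightarrow> nat \<Rightarrow> cmd \<Rightarrow> st \<Rightarrow> bool" where
  "safe xs M Skip s = True"
| "safe xs M (Asg v e) s = safeE xs M e s"
| "safe xs M (St a e1 e2) s = (safeE xs M e1 s \<and> safeE xs M e2 s \<and> eval xs e1 s < M)"
| "safe xs M (c1 ;; c2) s = (safe xs M c1 s \<and> safe xs M c2 (exec xs c1 s))"
| "safe xs M (IfLess a b c1 c2) s =
     (safeE xs M a s \<and> safeE xs M b s \<and>
      (if eval xs a s < eval xs b s then safe xs M c1 s else safe xs M c2 s))"
| "safe xs M (For v e c) s =
     (safeE xs M e s \<and> eval xs e s < M \<and>
      (\<forall>i < eval xs e s. safe xs M c (set_var v i (iter v (exec xs c) i s))))"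

fun sizeE :: "exp \<Rightarrow> nat" where
  "sizeE (Lit k) = 1"
| "sizeE (Var v) = 1"
| "sizeE (Bin f a b) = sizeE a + sizeE b + 1"
| "sizeE (Inp e) = sizeE e + 1"
| "sizeE (Ld a e) = sizeE e + 7"

text \<open>These are exact instruction counts. A round of a loop has five instructions besides its
  body (test, copy of the counter, constant 1, increment, jump back); outside the rounds there are
  the initial 0 and the last test with its exit jump. The else branch stands first in the code and
  pays for the jump over the other branch.\<close>

primrec cost :: "nat list \<Rightarrow> cmd \<Rightarrow> st \<Rightarrow> nat" where
  "cost xs Skip s = 0"
| "cost xs (Asg v e) s = sizeE e + 1"
| "cost xs (St a e1 e2) s = sizeE e1 + sizeE e2 + 7"
| "cost xs (c1 ;; c2) s = cost xs c1 s + cost xs c2 (exec xs c1 s)"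
| "cost xs (IfLess a b c1 c2) s = sizeE a + sizeE b + 1 +
     (if eval xs a s < eval xs b s then cost xs c1 s else cost xs c2 s + 1)"
| "cost xs (For v e c) s = sizeE e + 3 +
     (\<Sum>i < eval xs e s. cost xs c (set_var v i (iter v (exec xs c) i s)) + 5)"

section \<open>Compilation\<close>

definition num_arrays :: nat where "num_arrays = 16"

text \<open>Subtraction from 0 modulo \<open>2 ^ w\<close> counts addresses from the upper end of
  the memory although \<open>w\<close> does not occur in the code. \<open>Suc a\<close> makes
  \<open>2 ^ w - 1\<close> the first address.\<close>

definition addr :: "nat \<Rightarrow> nat \<Rightarrow> instr list" where
  "addr d a =
     [Const (Suc d) num_arrays, Op Mul d d (Suc d), Const (Suc d) (Suc a), Op Add d d (Suc d),
      Const (Suc d) 0, Op Sub d (Suc d) d]"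

text \<open>\<open>d\<close> is the first free scratch register, and everything below it survives.
  \<open>Op BitOr\<close> with equal arguments serves as a move.\<close>

fun compE :: "nat \<Rightarrow> exp \<Rightarrow> instr list" where
  "compE d (Lit k) = [Const d k]"
| "compE d (Var v) = [Op BitOr d v v]"
| "compE d (Bin f a b) = compE d a @ compE (Suc d) b @ [Op f d d (Suc d)]"
| "compE d (Inp e) = compE d e @ [Load d d]"
| "compE d (Ld a e) = compE d e @ addr d a @ [Load d d]"

fun sizeC :: "cmd \<Rightarrow> nat" where
  "sizeC Skip = 0"
| "sizeC (Asg v e) = sizeE e + 1"
| "sizeC (St a e1 e2) = sizeE e1 + sizeE e2 + 7"
| "sizeC (c1 ;; c2) = sizeC c1 + sizeC c2"
| "sizeC (IfLess a b c1 c2) = sizeE a + sizeE b + sizeC c1 + sizeC c2 + 2"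
| "sizeC (For v e c) = sizeE e + sizeC c + 7"

text \<open>Jumps are absolute, hence the position \<open>p\<close>. A loop keeps its counter and
  bound in the scratch registers \<open>d\<close> and \<open>d + 1\<close>, out of reach of the
  body, which is compiled for \<open>d + 2\<close>; the loop variable receives a mere copy of the
  counter.\<close>

fun compC :: "nat \<Rightarrow> nat \<Rightarrow> cmd \<Rightarrow> instr list" where
  "compC p d Skip = []"
| "compC p d (Asg v e) = compE d e @ [Op BitOr v d d]"
| "compC p d (St a e1 e2) = compE d e1 @ addr d a @ compE (Suc d) e2 @ [Store d (Suc d)]"
| "compC p d (c1 ;; c2) = compC p d c1 @ compC (p + sizeC c1) d c2"
| "compC p d (IfLess a b c1 c2) =
     (let q = p + sizeE a + sizeE b + 1 in
      compE d a @ compE (Suc d) b @ [JumpLess d (Suc d) (q + sizeC c2 + 1)] @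
      compC q d c2 @ [Jump (q + sizeC c2 + 1 + sizeC c1)] @ compC (q + sizeC c2 + 1) d c1)"
| "compC p d (For v e c) =
     (let q = p + sizeE e + 1 in
      compE (Suc d) e @ [Const d 0] @
      [JumpLess d (Suc d) (q + 2), Jump (q + sizeC c + 6), Op BitOr v d d] @
      compC (q + 3) (d + 2) c @
      [Const (d + 2) 1, Op Add d d (d + 2), Jump q])"

lemma length_addr [simp]: "length (addr d a) = 6"
  by (simp add: addr_def)

lemma length_compE [simp]: "length (compE d e) = sizeE e"
  by (induction d e rule: compE.induct) auto

lemma length_compC [simp]: "length (compC p d c) = sizeC c"
  by (induction p d c rule: compC.induct) (auto simp: Let_def)

fun vars_below :: "nat \<Rightarrow> exp \<Rightarrow> bool" where
  "vars_below d (Lit k) = True"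
| "vars_below d (Var v) = (v < d)"
| "vars_below d (Bin f a b) = (vars_below d a \<and> vars_below d b)"
| "vars_below d (Inp e) = vars_below d e"
| "vars_below d (Ld a e) = (a < num_arrays \<and> vars_below d e)"

fun well_formed :: "nat \<Rightarrow> cmd \<Rightarrow> bool" where
  "well_formed d Skip = True"
| "well_formed d (Asg v e) = (v < d \<and> vars_below d e)"
| "well_formed d (St a e1 e2) = (a < num_arrays \<and> vars_below d e1 \<and> vars_below d e2)"
| "well_formed d (c1 ;; c2) = (well_formed d c1 \<and> well_formed d c2)"
| "well_formed d (IfLess a b c1 c2) =
     (vars_below d a \<and> vars_below d b \<and> well_formed d c1 \<and> well_formed d c2)"
| "well_formed d (For v e c) = (v < d \<and> vars_below d e \<and> well_formed d c)"

section \<open>Simulation of structured programs by machine code\<close>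

definition code_at :: "instr list \<Rightarrow> nat \<Rightarrow> instr list \<Rightarrow> bool" where
  "code_at P p is \<longleftrightarrow> p + length is \<le> length P \<and> (\<forall>i < length is. P ! (p + i) = is ! i)"

lemma code_at_append [simp]:
  "code_at P p (is1 @ is2) \<longleftrightarrow> code_at P p is1 \<and> code_at P (p + length is1) is2"
proof
  assume c: "code_at P p (is1 @ is2)"
  have "P ! (p + i) = is1 ! i" if "i < length is1" for i
  proof -
    have "P ! (p + i) = (is1 @ is2) ! i" using c that unfolding code_at_def by simp
    then show ?thesis using that by (simp add: nth_append)
  qed
  moreover have "P ! (p + length is1 + i) = is2 ! i" if "i < length is2" for i
  proof -
    have "P ! (p + (length is1 + i)) = (is1 @ is2) ! (length is1 + i)"
      using c that unfolding code_at_def by (metis length_append nat_add_left_cancel_less)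
    then show ?thesis by (simp add: nth_append add.assoc)
  qed
  ultimately show "code_at P p is1 \<and> code_at P (p + length is1) is2"
    using c unfolding code_at_def by simp
next
  assume c: "code_at P p is1 \<and> code_at P (p + length is1) is2"
  have "P ! (p + i) = (is1 @ is2) ! i" if i: "i < length (is1 @ is2)" for i
  proof (cases "i < length is1")
    case True
    then show ?thesis using c by (simp add: nth_append code_at_def)
  next
    case False
    then obtain j where j: "i = length is1 + j" by (metis le_iff_add not_less)
    then show ?thesis using c i unfolding code_at_def by (simp add: nth_append add.assoc)
  qed
  then show "code_at P p (is1 @ is2)" using c unfolding code_at_def by simp
qed

lemma code_at_Cons [simp]:
  "code_at P p (i # is) \<longleftrightarrow> p < length P \<and> P ! p = i \<and> code_at P (Suc p) is"
proof -
  have "code_at P p ([i] @ is) \<longleftrightarrow> p < length P \<and> P ! p = i \<and> code_at P (Suc p) is"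
    unfolding code_at_append by (auto simp: code_at_def)
  then show ?thesis by simp
qed

lemma code_at_Nil [simp]: "code_at P p [] \<longleftrightarrow> p \<le> length P"
  by (simp add: code_at_def)

text \<open>The arrays are interleaved and grow downwards from the upper end of the memory, so that
  no base addresses are needed.\<close>

locale ram =
  fixes w :: nat and P :: "instr list" and xs :: "nat list" and M :: nat and d0 :: nat
  assumes fits: "num_arrays * (M + 1) + length xs < 2 ^ w"
begin

definition loc :: "nat \<Rightarrow> nat \<Rightarrow> nat" where
  "loc a i = 2 ^ w - (num_arrays * i + Suc a)"

definition sim :: "st \<Rightarrow> state \<Rightarrow> bool" where
  "sim s \<sigma> \<longleftrightarrow> (\<forall>v < d0. regs \<sigma> v = vars s v) \<and>
     (\<forall>a < num_arrays. \<forall>i < M. mem \<sigma> (loc a i) = arr s a i) \<and>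
     (\<forall>i < length xs. mem \<sigma> i = xs ! i)"

lemma loc_arg_le:
  assumes "a < num_arrays" "i < M"
  shows "num_arrays * i + Suc a + length xs < 2 ^ w"
proof -
  have "num_arrays * i + num_arrays \<le> num_arrays * M"
    using assms mult_le_mono2[of "i + 1" M num_arrays] by simp
  then show ?thesis using fits assms by simp
qed

lemma loc_eq:
  assumes "a < num_arrays" "i < M" "a' < num_arrays" "i' < M"
  shows "loc a i = loc a' i' \<longleftrightarrow> a = a' \<and> i = i'"
proof
  assume "loc a i = loc a' i'"
  then have "num_arrays * i + a = num_arrays * i' + a'"
    unfolding loc_def using loc_arg_le[of a i] loc_arg_le[of a' i'] assms by simp
  moreover have "(num_arrays * i + a) div num_arrays = i" "(num_arrays * i' + a') div num_arrays = i'"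
    using assms by simp_all
  ultimately show "a = a' \<and> i = i'" by (metis add_left_cancel)
qed auto

lemma loc_ge: "a < num_arrays \<Longrightarrow> i < M \<Longrightarrow> length xs \<le> loc a i"
  unfolding loc_def using loc_arg_le[of a i] by simp

definition steps :: "nat \<Rightarrow> state \<Rightarrow> state \<Rightarrow> bool" where
  "steps k \<sigma> \<sigma>' \<longleftrightarrow> (step w P ^^ k) \<sigma> = \<sigma>'"

lemma steps_0: "steps 0 \<sigma> \<sigma>"
  by (simp add: steps_def)

lemma steps_add: "steps j \<sigma> \<sigma>' \<Longrightarrow> steps k \<sigma>' \<sigma>'' \<Longrightarrow> steps (j + k) \<sigma> \<sigma>''"
  unfolding steps_def by (metis add.commute comp_apply funpow_add)

lemma steps_1: "pc \<sigma> < length P \<Longrightarrow> steps 1 \<sigma> (exec_instr w (P ! pc \<sigma>) \<sigma>)"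
  unfolding steps_def by (simp add: step_def halted_def)

lemma steps_instr:
  "pc \<sigma> < length P \<Longrightarrow> P ! pc \<sigma> = i \<Longrightarrow> steps 1 \<sigma> (exec_instr w i \<sigma>)"
  using steps_1 by blast

lemma steps_Suc:
  assumes "pc \<sigma> < length P" "steps k (exec_instr w (P ! pc \<sigma>) \<sigma>) \<sigma>'"
  shows "steps (Suc k) \<sigma> \<sigma>'"
  using steps_add[OF steps_1[OF assms(1)] assms(2)] by simp

lemma M_less: "x < M \<Longrightarrow> x < 2 ^ w"
  using fits by (simp add: num_arrays_def)

lemma word_op:
  assumes "op_safe M f x y"
  shows "binop_word w f x y = nat_op f x y"
proof (cases f)
  case Sub
  then have "y \<le> x" "x - y < 2 ^ w" using assms M_less by auto
  moreover from this have "x + 2 ^ w - y = (x - y) + 2 ^ w" by simp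
  ultimately show ?thesis using Sub
    by (simp add: take_bit_eq_mod del: Nat.add_diff_assoc2 Nat.add_diff_assoc)
qed (use assms M_less in \<open>auto simp: take_bit_nat_eq_self push_bit_eq_mult drop_bit_eq_div\<close>)

lemma addr_steps:
  assumes "code_at P p (addr d a)" "pc \<sigma> = p" "regs \<sigma> d = i" "i < M" "a < num_arrays"
  shows "\<exists>\<sigma>'. steps 6 \<sigma> \<sigma>' \<and> pc \<sigma>' = p + 6 \<and> regs \<sigma>' d = loc a i \<and>
    (\<forall>r < d. regs \<sigma>' r = regs \<sigma> r) \<and> mem \<sigma>' = mem \<sigma>"
proof -
  have le: "num_arrays * i + Suc a < 2 ^ w" using loc_arg_le[OF assms(5,4)] by simp
  then have t: "take_bit w num_arrays = num_arrays" "take_bit w (Suc a) = Suc a"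
    "take_bit w (i * num_arrays) = i * num_arrays"
    "take_bit w (i * num_arrays + Suc a) = i * num_arrays + Suc a"
    using fits by (auto simp: take_bit_nat_eq_self_iff algebra_simps)
  have t2: "take_bit w (2 ^ w - (i * num_arrays + Suc a)) = loc a i"
    using le by (simp add: take_bit_nat_eq_self_iff loc_def algebra_simps)
  show ?thesis
    \<comment> \<open>The witness is left as a sixfold execution of whatever instruction comes next;
      \<open>steps_Suc\<close> unwinds it.\<close>
    apply (rule exI[of _ "((\<lambda>\<sigma>. exec_instr w (P ! pc \<sigma>) \<sigma>) ^^ 6) \<sigma>"])
    using assms t t2 
    by (auto simp: addr_def numeral_eq_Suc simp del: take_bit_of_Suc_0 intro!: steps_Suc steps_0)
qed

lemma compE_steps:
  assumes "code_at P p (compE d e)" "sim s \<sigma>" "safeE xs M e s" "pc \<sigma> = p" "d0 \<le> d"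
    "vars_below d0 e"
  shows "\<exists>\<sigma>'. steps (sizeE e) \<sigma> \<sigma>' \<and> pc \<sigma>' = p + sizeE e \<and> regs \<sigma>' d = eval xs e s \<and>
    (\<forall>r < d. regs \<sigma>' r = regs \<sigma> r) \<and> mem \<sigma>' = mem \<sigma>"
  using assms
proof (induction d e arbitrary: p \<sigma> rule: compE.induct)
  case (1 d k)
  then have "k < M" by simp
  then have "take_bit w k = k" using M_less by (simp add: take_bit_nat_eq_self_iff)
  then show ?case using 1 steps_instr[of \<sigma> "Const d k"]
    by (intro exI[of _ "exec_instr w (Const d k) \<sigma>"]) auto
next
  case (2 d v)
  then show ?case using steps_instr[of \<sigma> "Op BitOr d v v"]
    by (intro exI[of _ "exec_instr w (Op BitOr d v v) \<sigma>"]) (auto simp: sim_def)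
next
  case (3 d f a b)
  from 3(1)[of p \<sigma>] 3(3-) obtain \<sigma>1 where 1: "steps (sizeE a) \<sigma> \<sigma>1" "pc \<sigma>1 = p + sizeE a"
    "regs \<sigma>1 d = eval xs a s" "\<forall>r < d. regs \<sigma>1 r = regs \<sigma> r" "mem \<sigma>1 = mem \<sigma>" by auto
  have "sim s \<sigma>1" using 1 3(4,7) by (auto simp: sim_def)
  with 3(2)[of "p + sizeE a" \<sigma>1] 3(3-) 1 obtain \<sigma>2 where 2: "steps (sizeE b) \<sigma>1 \<sigma>2"
    "pc \<sigma>2 = p + sizeE a + sizeE b" "regs \<sigma>2 (Suc d) = eval xs b s"
    "\<forall>r < Suc d. regs \<sigma>2 r = regs \<sigma>1 r" "mem \<sigma>2 = mem \<sigma>1" by auto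
  have 3: "steps 1 \<sigma>2 (exec_instr w (Op f d d (Suc d)) \<sigma>2)"
    using steps_1[of \<sigma>2] 3(3) 2 by (simp add: add.assoc)
  show ?case
    using steps_add[OF steps_add[OF 1(1) 2(1)] 3] 1 2 "3.prems"(3)
    by (intro exI[of _ "exec_instr w (Op f d d (Suc d)) \<sigma>2"]) (auto simp: word_op)
next
  case (4 d e)
  from 4(1)[of p \<sigma>] 4(2-) obtain \<sigma>1 where 1: "steps (sizeE e) \<sigma> \<sigma>1" "pc \<sigma>1 = p + sizeE e"
    "regs \<sigma>1 d = eval xs e s" "\<forall>r < d. regs \<sigma>1 r = regs \<sigma> r" "mem \<sigma>1 = mem \<sigma>" by auto
  have 2: "steps 1 \<sigma>1 (exec_instr w (Load d d) \<sigma>1)"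
    using steps_1[of \<sigma>1] 4(2) 1 by simp
  show ?case
    using steps_add[OF 1(1) 2] 1 4(3,4)
    by (intro exI[of _ "exec_instr w (Load d d) \<sigma>1"]) (auto simp: sim_def)
next
  case (5 d a e)
  from 5(1)[of p \<sigma>] 5(2-) obtain \<sigma>1 where 1: "steps (sizeE e) \<sigma> \<sigma>1" "pc \<sigma>1 = p + sizeE e"
    "regs \<sigma>1 d = eval xs e s" "\<forall>r < d. regs \<sigma>1 r = regs \<sigma> r" "mem \<sigma>1 = mem \<sigma>" by auto
  from addr_steps[OF _ 1(2,3), of a] 5(2-) obtain \<sigma>2 where 2: "steps 6 \<sigma>1 \<sigma>2"
    "pc \<sigma>2 = p + sizeE e + 6" "regs \<sigma>2 d = loc a (eval xs e s)"
    "\<forall>r < d. regs \<sigma>2 r = regs \<sigma>1 r" "mem \<sigma>2 = mem \<sigma>1" by auto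
  have 3: "steps 1 \<sigma>2 (exec_instr w (Load d d) \<sigma>2)"
    using steps_1[of \<sigma>2] 5(2) 2 by (simp add: add.assoc)
  show ?case
    using steps_add[OF steps_add[OF 1(1) 2(1)] 3] 1 2 5(3-)
    by (intro exI[of _ "exec_instr w (Load d d) \<sigma>2"]) (auto simp: sim_def algebra_simps)
qed

lemma sim_temps:
  assumes "sim s \<sigma>" "\<forall>r < d. regs \<sigma>' r = regs \<sigma> r" "mem \<sigma>' = mem \<sigma>" "d0 \<le> d"
  shows "sim s \<sigma>'"
  using assms by (auto simp: sim_def)

lemma sim_store:
  assumes "sim s \<sigma>" "a < num_arrays" "i < M"
    "\<forall>r < d. regs \<sigma>' r = regs \<sigma> r" "mem \<sigma>' = (mem \<sigma>)(loc a i := x)" "d0 \<le> d"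
  shows "sim (s\<lparr>arr := (arr s)(a := (arr s a)(i := x))\<rparr>) \<sigma>'"
  using assms loc_ge[OF assms(2,3)] by (auto simp: sim_def loc_eq)

text \<open>The last clause, on scratch registers below \<open>d\<close>, is what the loop case
  needs from its induction hypothesis, as counter and bound live there. Registers below
  \<open>d0\<close> are governed by \<open>sim\<close>.\<close>

lemma compC_steps:
  assumes "code_at P p (compC p d c)" "sim s \<sigma>" "safe xs M c s" "pc \<sigma> = p" "d0 \<le> d"
    "well_formed d0 c"
  shows "\<exists>\<sigma>'. steps (cost xs c s) \<sigma> \<sigma>' \<and> pc \<sigma>' = p + sizeC c \<and> sim (exec xs c s) \<sigma>' \<and>
    (\<forall>r. d0 \<le> r \<and> r < d \<longrightarrow> regs \<sigma>' r = regs \<sigma> r)"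
  using assms
proof (induction c arbitrary: p d s \<sigma>)
  case Skip
  then show ?case using steps_0 by auto
next
  case (Asg v e)
  from compE_steps[of p d e s \<sigma>] Asg obtain \<sigma>1 where 1: "steps (sizeE e) \<sigma> \<sigma>1"
    "pc \<sigma>1 = p + sizeE e" "regs \<sigma>1 d = eval xs e s" "\<forall>r < d. regs \<sigma>1 r = regs \<sigma> r"
    "mem \<sigma>1 = mem \<sigma>" by auto
  have 2: "steps 1 \<sigma>1 (exec_instr w (Op BitOr v d d) \<sigma>1)"
    using steps_instr[of \<sigma>1] Asg(1) 1 by simp
  show ?case
    using steps_add[OF 1(1) 2] 1 Asg
    by (intro exI[of _ "exec_instr w (Op BitOr v d d) \<sigma>1"]) (auto simp: sim_def)
next
  case (St a e1 e2)
  from compE_steps[of p d e1 s \<sigma>] St obtain \<sigma>1 where 1: "steps (sizeE e1) \<sigma> \<sigma>1"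
    "pc \<sigma>1 = p + sizeE e1" "regs \<sigma>1 d = eval xs e1 s" "\<forall>r < d. regs \<sigma>1 r = regs \<sigma> r"
    "mem \<sigma>1 = mem \<sigma>" by auto
  from addr_steps[OF _ 1(2,3), of a] St obtain \<sigma>2 where 2: "steps 6 \<sigma>1 \<sigma>2"
    "pc \<sigma>2 = p + sizeE e1 + 6" "regs \<sigma>2 d = loc a (eval xs e1 s)"
    "\<forall>r < d. regs \<sigma>2 r = regs \<sigma>1 r" "mem \<sigma>2 = mem \<sigma>1" by auto
  have "sim s \<sigma>2" using sim_temps[of s \<sigma> d \<sigma>2] St 1 2 by auto
  with compE_steps[of "p + sizeE e1 + 6" "Suc d" e2 s \<sigma>2] St 2(2) obtain \<sigma>3 where
    3: "steps (sizeE e2) \<sigma>2 \<sigma>3" "pc \<sigma>3 = p + sizeE e1 + 6 + sizeE e2"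
    "regs \<sigma>3 (Suc d) = eval xs e2 s" "\<forall>r < Suc d. regs \<sigma>3 r = regs \<sigma>2 r"
    "mem \<sigma>3 = mem \<sigma>2" by (auto simp: add.assoc)
  let ?\<sigma> = "exec_instr w (Store d (Suc d)) \<sigma>3"
  have 4: "steps 1 \<sigma>3 ?\<sigma>"
    using steps_instr[of \<sigma>3] St(1) 3 by (simp add: add.assoc)
  have "steps (cost xs (St a e1 e2) s) \<sigma> ?\<sigma>"
    using steps_add[OF steps_add[OF steps_add[OF 1(1) 2(1)] 3(1)] 4]
    by (simp add: algebra_simps numeral_eq_Suc)
  moreover have "sim (exec xs (St a e1 e2) s) ?\<sigma>"
    using sim_store[of s \<sigma> a "eval xs e1 s" d ?\<sigma> "eval xs e2 s"] St 1 2 3 by auto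
  ultimately show ?case
    using 1 2 3 by (intro exI[of _ ?\<sigma>] conjI) (auto simp: algebra_simps)
next
  case (Seq c1 c2)
  from Seq(1)[of p d s \<sigma>] Seq(3-) obtain \<sigma>1 where 1: "steps (cost xs c1 s) \<sigma> \<sigma>1"
    "pc \<sigma>1 = p + sizeC c1" "sim (exec xs c1 s) \<sigma>1"
    "\<forall>r. d0 \<le> r \<and> r < d \<longrightarrow> regs \<sigma>1 r = regs \<sigma> r" by auto
  from Seq(2)[of "p + sizeC c1" d "exec xs c1 s" \<sigma>1] Seq(3-) 1 obtain \<sigma>2 where
    2: "steps (cost xs c2 (exec xs c1 s)) \<sigma>1 \<sigma>2"
    "pc \<sigma>2 = p + sizeC c1 + sizeC c2" "sim (exec xs c2 (exec xs c1 s)) \<sigma>2"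
    "\<forall>r. d0 \<le> r \<and> r < d \<longrightarrow> regs \<sigma>2 r = regs \<sigma>1 r" by auto
  show ?case using steps_add[OF 1(1) 2(1)] 1 2 by (auto simp: add.assoc)
next
  case (IfLess a b c1 c2)
  define q where "q = p + sizeE a + sizeE b + 1"
  note code = IfLess(3)[unfolded compC.simps Let_def, folded q_def]
  from compE_steps[of p d a s \<sigma>] IfLess(4-) code obtain \<sigma>1 where 1: "steps (sizeE a) \<sigma> \<sigma>1"
    "pc \<sigma>1 = p + sizeE a" "regs \<sigma>1 d = eval xs a s" "\<forall>r < d. regs \<sigma>1 r = regs \<sigma> r"
    "mem \<sigma>1 = mem \<sigma>" by auto
  have "sim s \<sigma>1" using sim_temps[of s \<sigma> d \<sigma>1] IfLess 1 by auto
  with compE_steps[of "p + sizeE a" "Suc d" b s \<sigma>1] IfLess(4-) code 1(2) obtain \<sigma>2 where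
    2: "steps (sizeE b) \<sigma>1 \<sigma>2"
    "pc \<sigma>2 = p + sizeE a + sizeE b" "regs \<sigma>2 (Suc d) = eval xs b s"
    "\<forall>r < Suc d. regs \<sigma>2 r = regs \<sigma>1 r" "mem \<sigma>2 = mem \<sigma>1" by auto
  let ?\<sigma>3 = "exec_instr w (JumpLess d (Suc d) (q + sizeC c2 + 1)) \<sigma>2"
  have 3: "steps 1 \<sigma>2 ?\<sigma>3"
    using steps_instr[of \<sigma>2] code 2 by (simp add: add.assoc)
  have s3: "sim s ?\<sigma>3" using sim_temps[of s \<sigma> d ?\<sigma>3] IfLess 1 2 by auto
  have r3: "\<forall>r < d. regs ?\<sigma>3 r = regs \<sigma> r" using 1 2 by auto
  have d: "regs \<sigma>2 d = eval xs a s" using 1 2 by auto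
  note start = steps_add[OF steps_add[OF 1(1) 2(1)] 3]
  show ?case
  proof (cases "eval xs a s < eval xs b s")
    case True
    have "pc ?\<sigma>3 = q + sizeC c2 + 1" using True 2 d by simp
    with IfLess(1)[of "q + sizeC c2 + 1" d s ?\<sigma>3] IfLess(4-) True s3 code obtain \<sigma>4 where
      4: "steps (cost xs c1 s) ?\<sigma>3 \<sigma>4" "pc \<sigma>4 = q + sizeC c2 + 1 + sizeC c1"
      "sim (exec xs c1 s) \<sigma>4" "\<forall>r. d0 \<le> r \<and> r < d \<longrightarrow> regs \<sigma>4 r = regs ?\<sigma>3 r"
      by (auto simp: q_def algebra_simps)
    show ?thesis using steps_add[OF start 4(1)] 4 True r3
      by (intro exI[of _ \<sigma>4]) (auto simp: q_def algebra_simps)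
  next
    case False
    have "pc ?\<sigma>3 = q" using False 2 d by (simp add: q_def)
    with IfLess(2)[of q d s ?\<sigma>3] IfLess(4-) False s3 code obtain \<sigma>4 where
      4: "steps (cost xs c2 s) ?\<sigma>3 \<sigma>4" "pc \<sigma>4 = q + sizeC c2"
      "sim (exec xs c2 s) \<sigma>4" "\<forall>r. d0 \<le> r \<and> r < d \<longrightarrow> regs \<sigma>4 r = regs ?\<sigma>3 r"
      by (auto simp: q_def algebra_simps)
    let ?\<sigma>5 = "exec_instr w (Jump (q + sizeC c2 + 1 + sizeC c1)) \<sigma>4"
    have 5: "steps 1 \<sigma>4 ?\<sigma>5"
      using steps_instr[of \<sigma>4] code 4 by (simp add: q_def add.assoc)
    have "sim (exec xs c2 s) ?\<sigma>5" using 4 by (simp add: sim_def)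
    then show ?thesis using steps_add[OF steps_add[OF start 4(1)] 5] 4 False r3
      by (intro exI[of _ ?\<sigma>5]) (auto simp: q_def algebra_simps)
  qed
next
  case (For v e c)
  define q where "q = p + sizeE e + 1"
  define k where "k = eval xs e s"
  note code = For(2)[unfolded compC.simps Let_def, folded q_def]
  let ?s = "\<lambda>i. iter v (exec xs c) i s"
  have km: "k < M" using For(4) by (simp add: k_def)
  from compE_steps[of p "Suc d" e s \<sigma>] For(3-) code obtain \<sigma>1 where 1: "steps (sizeE e) \<sigma> \<sigma>1"
    "pc \<sigma>1 = p + sizeE e" "regs \<sigma>1 (Suc d) = k" "\<forall>r < Suc d. regs \<sigma>1 r = regs \<sigma> r"
    "mem \<sigma>1 = mem \<sigma>" by (auto simp: k_def)
  let ?\<sigma>2 = "exec_instr w (Const d 0) \<sigma>1"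
  have 2: "steps 1 \<sigma>1 ?\<sigma>2" using steps_instr[of \<sigma>1] code 1 by simp
  \<comment> \<open>The situation at the loop head after \<open>i\<close> rounds, just before the
    test.\<close>
  let ?inv = "\<lambda>i \<sigma>'. pc \<sigma>' = q \<and> sim (?s i) \<sigma>' \<and>
    regs \<sigma>' d = i \<and> regs \<sigma>' (Suc d) = k \<and> (\<forall>r. d0 \<le> r \<and> r < d \<longrightarrow> regs \<sigma>' r = regs \<sigma> r)"
  have inv: "\<exists>\<sigma>'. steps (\<Sum>j < i. cost xs c (set_var v j (?s j)) + 5) ?\<sigma>2 \<sigma>' \<and> ?inv i \<sigma>'"
    if "i \<le> k" for i
    using that
  proof (induction i)
    case 0
    have "sim s ?\<sigma>2" using sim_temps[of s \<sigma> d ?\<sigma>2] For 1 by auto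
    then show ?case using 1 steps_0 by (intro exI[of _ ?\<sigma>2]) (auto simp: q_def)
  next
    case (Suc i)
    then obtain \<sigma>3 where 3: "steps (\<Sum>j < i. cost xs c (set_var v j (?s j)) + 5) ?\<sigma>2 \<sigma>3"
      "?inv i \<sigma>3" using Suc_leD by blast
    let ?\<sigma>4 = "exec_instr w (JumpLess d (Suc d) (q + 2)) \<sigma>3"
    have 4: "steps 1 \<sigma>3 ?\<sigma>4" using steps_instr[of \<sigma>3] code 3 by (simp add: q_def)
    have p4: "pc ?\<sigma>4 = q + 2" using 3 Suc by simp
    let ?\<sigma>5 = "exec_instr w (Op BitOr v d d) ?\<sigma>4"
    have "steps 1 ?\<sigma>4 (exec_instr w (P ! pc ?\<sigma>4) ?\<sigma>4)"
      using p4 code by (intro steps_1) (simp add: q_def)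
    then have 5: "steps 1 ?\<sigma>4 ?\<sigma>5" unfolding p4 using code by (simp add: q_def)
    have s5: "sim (set_var v i (?s i)) ?\<sigma>5" using 3 For(5,6) For(7) by (auto simp: sim_def)
    have p5: "pc ?\<sigma>5 = q + 3" using p4 by simp
    have "safe xs M c (set_var v i (?s i))" using For(4) Suc(2) by (simp add: k_def)
    with For(1)[of "q + 3" "d + 2" "set_var v i (?s i)" ?\<sigma>5] s5 p5 For(6,7) code
    obtain \<sigma>6 where 6: "steps (cost xs c (set_var v i (?s i))) ?\<sigma>5 \<sigma>6"
      "pc \<sigma>6 = q + 3 + sizeC c" "sim (?s (Suc i)) \<sigma>6"
      "\<forall>r. d0 \<le> r \<and> r < d + 2 \<longrightarrow> regs \<sigma>6 r = regs ?\<sigma>5 r"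
      by (auto simp: q_def numeral_eq_Suc)
    let ?\<sigma>7 = "exec_instr w (Const (d + 2) 1) \<sigma>6"
    have 7: "steps 1 \<sigma>6 ?\<sigma>7" using steps_instr[of \<sigma>6] code 6 by (simp add: q_def numeral_eq_Suc)
    let ?\<sigma>8 = "exec_instr w (Op Add d d (d + 2)) ?\<sigma>7"
    have 8: "steps 1 ?\<sigma>7 ?\<sigma>8"
      using steps_instr[of ?\<sigma>7] code 6 by (simp add: q_def numeral_eq_Suc)
    let ?\<sigma>9 = "exec_instr w (Jump q) ?\<sigma>8"
    have 9: "steps 1 ?\<sigma>8 ?\<sigma>9"
      using steps_instr[of ?\<sigma>8] code 6 by (simp add: q_def numeral_eq_Suc)
    have r6: "regs \<sigma>6 d = i" "regs \<sigma>6 (Suc d) = k"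
      "\<forall>r. d0 \<le> r \<and> r < d \<longrightarrow> regs \<sigma>6 r = regs \<sigma> r"
      using 6(4) 3 For(6,7) by auto
    have w1: "Suc i < 2 ^ w" using Suc(2) km M_less[OF km] by simp
    \<comment> \<open>This excludes \<open>w = 0\<close>, where \<open>Const\<close> would truncate
      1 to 0.\<close>
    then have "(1::nat) < 2 ^ w" by simp
    then have t1: "take_bit w (Suc 0) = Suc 0" by (simp add: take_bit_nat_eq_self_iff del: take_bit_of_Suc_0)
    have "regs ?\<sigma>9 d = Suc i"
      using r6 w1 by (simp add: t1 take_bit_nat_eq_self_iff del: take_bit_of_Suc_0)
    moreover have "sim (?s (Suc i)) ?\<sigma>9" using 6(3) For(6) by (auto simp: sim_def)
    ultimately have inv9: "?inv (Suc i) ?\<sigma>9" using r6 by simp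
    have eq: "(\<Sum>j < i. cost xs c (set_var v j (?s j)) + 5) + 1 + 1 +
        cost xs c (set_var v i (?s i)) + 1 + 1 + 1 =
      (\<Sum>j < Suc i. cost xs c (set_var v j (?s j)) + 5)" by simp
    note all = steps_add[OF steps_add[OF steps_add[OF steps_add[OF steps_add[OF steps_add[OF
      3(1) 4] 5] 6(1)] 7] 8] 9]
    define \<tau> where "\<tau> = ?\<sigma>9"
    have "steps (\<Sum>j < Suc i. cost xs c (set_var v j (?s j)) + 5) ?\<sigma>2 \<tau>"
      using all unfolding \<tau>_def eq .
    moreover have "?inv (Suc i) \<tau>" using inv9 unfolding \<tau>_def .
    ultimately show ?case by blast
  qed
  from inv[of k] obtain \<sigma>3 where 3: "steps (\<Sum>j < k. cost xs c (set_var v j (?s j)) + 5) ?\<sigma>2 \<sigma>3"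
    "?inv k \<sigma>3" by blast
  let ?\<sigma>4 = "exec_instr w (JumpLess d (Suc d) (q + 2)) \<sigma>3"
  have 4: "steps 1 \<sigma>3 ?\<sigma>4" using steps_instr[of \<sigma>3] code 3 by (simp add: q_def)
  have p4: "pc ?\<sigma>4 = q + 1" using 3 by simp
  let ?\<sigma>5 = "exec_instr w (Jump (q + sizeC c + 6)) ?\<sigma>4"
  have "steps 1 ?\<sigma>4 (exec_instr w (P ! pc ?\<sigma>4) ?\<sigma>4)"
    using p4 code by (intro steps_1) (simp add: q_def)
  then have 5: "steps 1 ?\<sigma>4 ?\<sigma>5" unfolding p4 using code by (simp add: q_def)
  have s5: "sim (?s k) ?\<sigma>5" using 3 by (auto simp: sim_def)
  have eq: "sizeE e + 1 + (\<Sum>j < k. cost xs c (set_var v j (?s j)) + 5) + 1 + 1 =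
    cost xs (For v e c) s" by (simp add: k_def)
  note all = steps_add[OF steps_add[OF steps_add[OF steps_add[OF 1(1) 2] 3(1)] 4] 5]
  show ?case
    using all[unfolded eq] s5 3
    by (intro exI[of _ ?\<sigma>5] conjI) (simp_all add: q_def k_def)
qed

end

text \<open>Zero registers and zero memory beyond the input already represent the initial store,
  since \<open>loc_ge\<close> keeps the arrays clear of the input. The code halts by running off its
  end.\<close>

theorem compC_decides:
  assumes fits: "num_arrays * (M + 1) + length xs < 2 ^ w"
    and wf: "well_formed d c" and d: "0 < d"
    and safe: "safe xs M c \<lparr>vars = \<lambda>_. 0, arr = \<lambda>_ _. 0\<rparr>"
    and res: "vars (exec xs c \<lparr>vars = \<lambda>_. 0, arr = \<lambda>_ _. 0\<rparr>) 0 = (if answer then 1 else 0)"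
    and time: "real (cost xs c \<lparr>vars = \<lambda>_. 0, arr = \<lambda>_ _. 0\<rparr>) \<le> T"
  shows "decides_within w (compC 0 d c) xs answer T"
proof -
  define P where "P = compC 0 d c"
  interpret ram w P xs M d by unfold_locales (fact fits)
  have "code_at P 0 (compC 0 d c)" by (simp add: P_def code_at_def)
  moreover have "sim \<lparr>vars = \<lambda>_. 0, arr = \<lambda>_ _. 0\<rparr> (init_state xs)"
    by (auto simp: sim_def init_state_def dest: loc_ge)
  ultimately obtain \<sigma>' where
    "steps (cost xs c \<lparr>vars = \<lambda>_. 0, arr = \<lambda>_ _. 0\<rparr>) (init_state xs) \<sigma>'"
    "pc \<sigma>' = sizeC c" "sim (exec xs c \<lparr>vars = \<lambda>_. 0, arr = \<lambda>_ _. 0\<rparr>) \<sigma>'"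
    using compC_steps[of 0 d c _ "init_state xs"] wf safe by (auto simp: init_state_def)
  then show ?thesis
    using res time d unfolding decides_within_def steps_def sim_def halted_def P_def[symmetric]
    by (intro exI[of _ "cost xs c \<lparr>vars = \<lambda>_. 0, arr = \<lambda>_ _. 0\<rparr>"]) (auto simp: P_def)
qed

section \<open>Postfix notation\<close>

text \<open>A subtree is named by the position of its last token, which is its root. The stack holds
  the finished subtrees among the first \<open>t\<close> tokens, top first; so the right operand of
  an operator at \<open>t\<close> is always \<open>t - 1\<close>, and the left one is the second
  entry.\<close>

primrec stk :: "(nat \<Rightarrow> nat) \<Rightarrow> nat \<Rightarrow> nat list" where
  "stk tk 0 = []"
| "stk tk (Suc t) = t # (if tk t < 2 then drop 2 (stk tk t) else stk tk t)"

definition lc :: "(nat \<Rightarrow> nat) \<Rightarrow> nat \<Rightarrow> nat" where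
  "lc tk t = stk tk t ! 1"

lemma stk_less: "set (stk tk t) \<subseteq> {..<t}"
proof (induction t)
  case (Suc t)
  then show ?case using set_drop_subset[of 2 "stk tk t"] by (auto simp: less_Suc_eq)
qed simp

lemma lc_less: "2 \<le> length (stk tk t) \<Longrightarrow> lc tk t < t"
proof -
  assume "2 \<le> length (stk tk t)"
  then have "stk tk t ! 1 \<in> set (stk tk t)" by (intro nth_mem) simp
  then show ?thesis unfolding lc_def using stk_less by blast
qed

text \<open>The test \<open>0 < t \<and> lc tk t < t\<close> holds for the operators of an encoded formula; here and
  in the recursions below it is there for termination only.\<close>

function val :: "(nat \<Rightarrow> nat) \<Rightarrow> (nat \<Rightarrow> bool) \<Rightarrow> nat \<Rightarrow> bool" where
  "val tk lv t =
     (if 2 \<le> tk t \<or> \<not> (0 < t \<and> lc tk t < t) then lv (tk t)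
      else if tk t = 0 then val tk lv (lc tk t) \<and> val tk lv (t - 1)
      else val tk lv (lc tk t) \<or> val tk lv (t - 1))"
  by pat_completeness auto
termination by (relation "measure (\<lambda>(_, _, t). t)") auto

declare val.simps [simp del]

definition wf_tokens :: "(nat \<Rightarrow> nat) \<Rightarrow> nat \<Rightarrow> bool" where
  "wf_tokens tk t \<longleftrightarrow> 0 < t \<and> 2 \<le> length (stk tk t) \<and> stk tk t ! 0 = t - 1"

text \<open>The start \<open>t0\<close> is arbitrary for the sake of induction: the right operand is
  parsed on top of the left one, whose entry stays untouched below it. \<open>lv\<close> assigns a
  value to a leaf from its token alone.\<close>

lemma parse:
  assumes "\<And>i. i < length (encode_formula F) \<Longrightarrow> tk (t0 + i) = encode_formula F ! i"
    and "\<And>v. v \<in> set (leaf_vars F) \<Longrightarrow> lv (2 * encode_var v + 2) = eval_var a b v"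
    and "\<And>v. v \<in> set (leaf_vars F) \<Longrightarrow> lv (2 * encode_var v + 3) = (\<not> eval_var a b v)"
    and "t1 = t0 + length (encode_formula F)"
  shows "t0 < t1 \<and> stk tk t1 = (t1 - 1) # stk tk t0 \<and>
    (\<forall>t. t0 \<le> t \<longrightarrow> t < t1 \<longrightarrow> tk t < 2 \<longrightarrow> wf_tokens tk t) \<and>
    val tk lv (t1 - 1) = eval_formula a b F"
  using assms
proof (induction F arbitrary: t0 t1)
  case (Pos v)
  then show ?case by (auto simp: val.simps less_Suc_eq)
next
  case (Neg v)
  then show ?case by (auto simp: val.simps less_Suc_eq)
next
  case (And f g)
  define u where "u = t0 + length (encode_formula f)"
  define v where "v = u + length (encode_formula g)"
  have 1: "tk (t0 + i) = encode_formula f ! i" if "i < length (encode_formula f)" for i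
    using And(3)[of i] that by (simp add: nth_append)
  have 2: "tk (u + i) = encode_formula g ! i" if "i < length (encode_formula g)" for i
    using And(3)[of "length (encode_formula f) + i"] that by (simp add: nth_append add.assoc u_def)
  have 3: "tk v = 0"
    using And(3)[of "length (encode_formula f) + length (encode_formula g)"]
    by (simp add: nth_append add.assoc u_def v_def)
  have f: "t0 < u" "stk tk u = (u - 1) # stk tk t0"
    "\<And>t. t0 \<le> t \<Longrightarrow> t < u \<Longrightarrow> tk t < 2 \<Longrightarrow> wf_tokens tk t"
    "val tk lv (u - 1) = eval_formula a b f"
    using And(1)[of t0 u] And(4,5) 1 u_def by simp_all
  have g: "u < v" "stk tk v = (v - 1) # stk tk u"
    "\<And>t. u \<le> t \<Longrightarrow> t < v \<Longrightarrow> tk t < 2 \<Longrightarrow> wf_tokens tk t"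
    "val tk lv (v - 1) = eval_formula a b g"
    using And(2)[of u v] And(4,5) 2 v_def by simp_all
  have t1: "t1 = Suc v" using And(6) by (simp add: u_def v_def)
  have s: "stk tk v = (v - 1) # (u - 1) # stk tk t0" using f g by simp
  have wf: "wf_tokens tk v" using s f g by (simp add: wf_tokens_def)
  have "lc tk v = u - 1" unfolding lc_def s by simp
  then have "val tk lv v = (val tk lv (u - 1) \<and> val tk lv (v - 1))"
    using 3 f(1) g(1) by (subst val.simps) auto
  moreover have "wf_tokens tk t" if "t0 \<le> t" "t < t1" "tk t < 2" for t
    using f(3)[of t] g(3)[of t] wf that unfolding t1 by (metis less_SucE not_less)
  ultimately show ?case using f(1,4) g(1,4) s 3 unfolding t1 by simp
next
  case (Or f g)
  define u where "u = t0 + length (encode_formula f)"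
  define v where "v = u + length (encode_formula g)"
  have 1: "tk (t0 + i) = encode_formula f ! i" if "i < length (encode_formula f)" for i
    using Or(3)[of i] that by (simp add: nth_append)
  have 2: "tk (u + i) = encode_formula g ! i" if "i < length (encode_formula g)" for i
    using Or(3)[of "length (encode_formula f) + i"] that by (simp add: nth_append add.assoc u_def)
  have 3: "tk v = 1"
    using Or(3)[of "length (encode_formula f) + length (encode_formula g)"]
    by (simp add: nth_append add.assoc u_def v_def)
  have f: "t0 < u" "stk tk u = (u - 1) # stk tk t0"
    "\<And>t. t0 \<le> t \<Longrightarrow> t < u \<Longrightarrow> tk t < 2 \<Longrightarrow> wf_tokens tk t"
    "val tk lv (u - 1) = eval_formula a b f"
    using Or(1)[of t0 u] Or(4,5) 1 u_def by simp_all
  have g: "u < v" "stk tk v = (v - 1) # stk tk u"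
    "\<And>t. u \<le> t \<Longrightarrow> t < v \<Longrightarrow> tk t < 2 \<Longrightarrow> wf_tokens tk t"
    "val tk lv (v - 1) = eval_formula a b g"
    using Or(2)[of u v] Or(4,5) 2 v_def by simp_all
  have t1: "t1 = Suc v" using Or(6) by (simp add: u_def v_def)
  have s: "stk tk v = (v - 1) # (u - 1) # stk tk t0" using f g by simp
  have wf: "wf_tokens tk v" using s f g by (simp add: wf_tokens_def)
  have "lc tk v = u - 1" unfolding lc_def s by simp
  then have "val tk lv v = (val tk lv (u - 1) \<or> val tk lv (v - 1))"
    using 3 f(1) g(1) by (subst val.simps) auto
  moreover have "wf_tokens tk t" if "t0 \<le> t" "t < t1" "tk t < 2" for t
    using f(3)[of t] g(3)[of t] wf that unfolding t1 by (metis less_SucE not_less)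
  ultimately show ?case using f(1,4) g(1,4) s 3 unfolding t1 by simp
qed

lemma length_encode_formula: "length (encode_formula F) + 1 = 2 * length (leaf_vars F)"
  by (induction F) auto

text \<open>This fixes the layout of the input: with \<open>2 * m\<close> leaves the formula takes
  \<open>4 * m - 1\<close> words, so the vectors start at position \<open>4 * m + 1\<close>.\<close>

lemma length_leaf_vars:
  assumes "each_var_once m F"
  shows "length (leaf_vars F) = 2 * m"
proof -
  have "length (leaf_vars F) = card (X ` {..<m} \<union> Y ` {..<m})"
    using assms distinct_card unfolding each_var_once_def by metis
  also have "\<dots> = card (X ` {..<m}) + card (Y ` {..<m})"
    by (intro card_Un_disjoint) auto
  also have "\<dots> = 2 * m"
    by (simp add: card_image inj_on_def)
  finally show ?thesis .
qed

lemma encode_formula_leaf: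
  "x \<in> set (encode_formula F) \<Longrightarrow> 2 \<le> x \<Longrightarrow>
    \<exists>v \<in> set (leaf_vars F). x = 2 * encode_var v + 2 \<or> x = 2 * encode_var v + 3"
  by (induction F) auto

section \<open>Decomposition into pieces\<close>

text \<open>\<open>encode_formula\<close> encodes \<open>X i\<close> as \<open>4 * i + 2\<close> and \<open>Y i\<close> as \<open>4 * i + 4\<close>, plus 1 if the
  leaf is negated.\<close>

definition is_X :: "nat \<Rightarrow> bool" where "is_X k \<longleftrightarrow> (k - 2) mod 4 < 2"
definition coord :: "nat \<Rightarrow> nat" where "coord k = (k - 2) div 4"

locale pieces =
  fixes tk :: "nat \<Rightarrow> nat" and W :: nat and s :: nat
  assumes wf: "t < W \<Longrightarrow> tk t < 2 \<Longrightarrow> wf_tokens tk t" and s_pos: "0 < s"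
begin

abbreviation l :: "nat \<Rightarrow> nat" where "l \<equiv> lc tk"

lemma l_less: "t < W \<Longrightarrow> tk t < 2 \<Longrightarrow> l t < t"
  using wf lc_less unfolding wf_tokens_def by blast

lemma op_pos: "t < W \<Longrightarrow> tk t < 2 \<Longrightarrow> 0 < t"
  using wf unfolding wf_tokens_def by blast

lemma stk_op:
  assumes "t < W" "tk t < 2"
  shows "stk tk t = (t - 1) # l t # drop 2 (stk tk t)"
proof -
  obtain a b c where "stk tk t = a # b # c"
    using wf[OF assms] unfolding wf_tokens_def
    by (metis Suc_le_length_iff numeral_2_eq_2)
  then show ?thesis using wf[OF assms] unfolding wf_tokens_def lc_def by simp
qed

text \<open>\<open>info t\<close> consists of the number of X-leaves and of the hole of the piece that is open at the
  root of the subtree ending at token \<open>t\<close>.  A hole is named by the token whose value is plugged in; 0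
  means that there is none, which is unambiguous because token 0 is a leaf.  A cut closes the
  pieces of both children and opens a piece that is nothing but a hole.\<close>

function info :: "nat \<Rightarrow> nat \<times> nat" where
  "info t =
     (if 2 \<le> tk t \<or> \<not> (0 < t \<and> l t < t) then (of_bool (is_X (tk t)), 0)
      else
        (if s < fst (info (l t)) + fst (info (t - 1)) \<or>
            0 < snd (info (l t)) \<and> 0 < snd (info (t - 1)) then (0, t)
         else (fst (info (l t)) + fst (info (t - 1)), snd (info (l t)) + snd (info (t - 1)))))"
  by pat_completeness auto
termination by (relation "measure id") auto

declare info.simps [simp del]

definition kk :: "nat \<Rightarrow> nat" where "kk t = fst (info t)"
definition ho :: "nat \<Rightarrow> nat" where "ho t = snd (info t)"
text \<open>Without a cut at most one of the two holes is nonzero, so their sum in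
  \<open>info\<close> is the hole that remains. An index into the table of a piece then needs one
  bit for the hole and at most \<open>s\<close> bits for the X-leaves.\<close>

definition cut :: "nat \<Rightarrow> bool" where
  "cut t \<longleftrightarrow> s < kk (l t) + kk (t - 1) \<or> 0 < ho (l t) \<and> 0 < ho (t - 1)"

lemma kk_leaf: "2 \<le> tk t \<Longrightarrow> kk t = of_bool (is_X (tk t))"
  and ho_leaf: "2 \<le> tk t \<Longrightarrow> ho t = 0"
  unfolding kk_def ho_def by (subst info.simps, simp)+

lemma kk_op: "t < W \<Longrightarrow> tk t < 2 \<Longrightarrow> kk t = (if cut t then 0 else kk (l t) + kk (t - 1))"
  and ho_op: "t < W \<Longrightarrow> tk t < 2 \<Longrightarrow> ho t = (if cut t then t else ho (l t) + ho (t - 1))"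
  unfolding kk_def ho_def cut_def
  using op_pos[of t] l_less[of t] by (subst info.simps, simp)+

lemma kk_le: "t < W \<Longrightarrow> kk t \<le> s"
  using s_pos by (cases "tk t < 2") (auto simp: kk_leaf kk_op cut_def)

lemma ho_le: "t < W \<Longrightarrow> ho t \<le> t"
proof (induction t rule: less_induct)
  case (less t)
  show ?case
  proof (cases "tk t < 2")
    case True
    then have "l t < t" "0 < t" "t < W" using less(2) l_less op_pos by auto
    moreover from this have "ho (l t) \<le> l t" "ho (t - 1) \<le> t - 1" using less(1) by auto
    ultimately show ?thesis using True by (auto simp: ho_op cut_def)
  qed (simp add: ho_leaf)
qed

text \<open>The holes of both operands lie strictly before \<open>t\<close>, so only a cut can
  produce the hole \<open>t\<close>. The program thus recognises cuts by comparing
  \<open>aHO\<close> with the token and stores no separate mark.\<close>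

lemma ho_eq_iff_cut:
  assumes "t < W" "tk t < 2"
  shows "ho t < t \<longleftrightarrow> \<not> cut t"
proof -
  have "l t < t" "0 < t" using assms l_less op_pos by auto
  moreover from this have "ho (l t) \<le> l t" "ho (t - 1) \<le> t - 1" using assms(1) ho_le by auto
  ultimately show ?thesis using assms by (auto simp: ho_op cut_def)
qed

section \<open>Cut tokens and their number\<close>

definition evs :: "nat \<Rightarrow> nat list" where
  "evs t = filter (\<lambda>t. tk t < 2 \<and> cut t) [0..<t]"

lemma evs_0 [simp]: "evs 0 = []" by (simp add: evs_def)

lemma evs_Suc: "evs (Suc t) = (if tk t < 2 \<and> cut t then evs t @ [t] else evs t)"
  by (simp add: evs_def)

lemma set_evs: "set (evs t) = {u. u < t \<and> tk u < 2 \<and> cut u}"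
  by (auto simp: evs_def)

text \<open>Followed down the tree, a hole stems from exactly one operand at every gate that is not
  cut, until the cut that created it is reached.\<close>

lemma ho_event: "t < W \<Longrightarrow> 0 < ho t \<Longrightarrow> ho t \<in> set (evs (Suc t))"
proof (induction t rule: less_induct)
  case (less t)
  then have op: "tk t < 2" using ho_leaf not_less by force
  then have lt: "l t < t" "0 < t" using less(2) l_less op_pos by auto
  show ?case
  proof (cases "cut t")
    case True
    then show ?thesis using op less(2) by (simp add: ho_op evs_Suc)
  next
    case False
    then have "ho t = ho (l t) + ho (t - 1)" "ho (l t) = 0 \<or> ho (t - 1) = 0"
      using less(2) op by (simp add: ho_op) (use False in \<open>auto simp only: cut_def\<close>)
    then have "ho t = ho (l t) \<and> 0 < ho (l t) \<or> ho t = ho (t - 1) \<and> 0 < ho (t - 1)"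
      using less(3) by linarith
    then have "ho t \<in> set (evs (Suc (l t))) \<or> ho t \<in> set (evs (Suc (t - 1)))"
      using less(1)[of "l t"] less(1)[of "t - 1"] lt less(2) by auto
    then show ?thesis using lt unfolding set_evs by fastforce
  qed
qed

lemma evs_sorted: "sorted_wrt (<) (evs t)"
  by (simp add: evs_def sorted_wrt_filter)

text \<open>A leaf adds at most 2 to the total potential of the stack, and a cut removes \<open>s + 1\<close>; this
  bounds the number of cuts.\<close>

definition pot :: "nat \<Rightarrow> nat" where
  "pot t = 2 * kk t + (if 0 < ho t then s + 1 else 0)"

text \<open>A cut forced by X-leaves finds at least \<open>s + 1\<close> of them, worth 2 each; a
  cut forced by two holes finds \<open>s + 1\<close> for each hole. Either way
  \<open>2 * (s + 1)\<close> is present, and the new hole takes back only \<open>s + 1\<close>.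
  Gates that are not cut preserve the potential.\<close>

lemma evs_potential:
  "t \<le> W \<Longrightarrow> (s + 1) * length (evs t) + sum_list (map pot (stk tk t)) \<le> 2 * t"
proof (induction t)
  case (Suc t)
  show ?case
  proof (cases "tk t < 2")
    case True
    let ?r = "drop 2 (stk tk t)"
    have "sum_list (map pot (stk tk t)) = pot (t - 1) + (pot (l t) + sum_list (map pot ?r))"
      by (subst stk_op) (use True Suc in auto)
    moreover have "pot t + (if cut t then s + 1 else 0) \<le> pot (l t) + pot (t - 1)"
    proof (cases "cut t")
      case c: True
      then have "s < kk (l t) + kk (t - 1) \<or> 0 < ho (l t) \<and> 0 < ho (t - 1)"
        by (simp only: cut_def)
      moreover have "kk t = 0" using c True Suc(2) by (simp add: kk_op)
      ultimately show ?thesis using c by (auto simp: pot_def)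
    next
      case c: False
      then have "ho (l t) = 0 \<or> ho (t - 1) = 0" by (auto simp only: cut_def)
      moreover have "kk t = kk (l t) + kk (t - 1)" "ho t = ho (l t) + ho (t - 1)"
        using c True Suc(2) by (simp_all add: kk_op ho_op)
      ultimately show ?thesis using c by (auto simp: pot_def)
    qed
    ultimately show ?thesis using True Suc by (cases "cut t") (simp_all add: evs_Suc)
  next
    case False
    then show ?thesis using Suc by (simp add: evs_Suc pot_def kk_leaf ho_leaf)
  qed
qed simp

text \<open>\<open>al xa t\<close> is the assignment \<open>xa\<close> restricted to the X-leaves of the open piece at \<open>t\<close>, read
  as a binary number.\<close>

function al :: "(nat \<Rightarrow> bool) \<Rightarrow> nat \<Rightarrow> nat" where
  "al xa t =
     (if 2 \<le> tk t \<or> \<not> (0 < t \<and> l t < t) then of_bool (is_X (tk t) \<and> xa (coord (tk t)))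
      else if cut t then 0
      else al xa (l t) * 2 ^ kk (t - 1) + al xa (t - 1))"
  by pat_completeness auto
termination by (relation "measure (\<lambda>(_, t). t)") auto

declare al.simps [simp del]

lemma al_leaf: "2 \<le> tk t \<Longrightarrow> al xa t = of_bool (is_X (tk t) \<and> xa (coord (tk t)))"
  by (subst al.simps) simp

lemma al_op: "t < W \<Longrightarrow> tk t < 2 \<Longrightarrow>
    al xa t = (if cut t then 0 else al xa (l t) * 2 ^ kk (t - 1) + al xa (t - 1))"
  using op_pos[of t] l_less[of t] by (subst al.simps) simp

lemma al_less: "t < W \<Longrightarrow> al xa t < 2 ^ kk t"
proof (induction t rule: less_induct)
  case (less t)
  show ?case
  proof (cases "tk t < 2")
    case True
    show ?thesis
    proof (cases "cut t")
      case False
      have lt: "l t < t" "0 < t" using True less(2) l_less op_pos by auto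
      have "al xa (l t) < 2 ^ kk (l t)" "al xa (t - 1) < 2 ^ kk (t - 1)"
        using less(1)[of "l t"] less(1)[of "t - 1"] lt less(2) by auto
      moreover from this have
        "al xa (l t) * 2 ^ kk (t - 1) + 2 ^ kk (t - 1) \<le> 2 ^ kk (l t) * 2 ^ kk (t - 1)"
        using mult_le_mono1[of "al xa (l t) + 1" "2 ^ kk (l t)" "2 ^ kk (t - 1)"] by simp
      ultimately show ?thesis using True False less(2) by (simp add: al_op kk_op power_add)
    qed (use True less(2) in \<open>simp add: al_op kk_op\<close>)
  qed (simp add: al_leaf kk_leaf)
qed

text \<open>With \<open>N\<close> the all-ones word this is a conjunction for \<open>k = 0\<close> and a disjunction for \<open>k = 1\<close>,
  the tokens of the two gates.\<close>

definition opw :: "nat \<Rightarrow> nat \<Rightarrow> nat \<Rightarrow> nat \<Rightarrow> nat" where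
  "opw N k a b = or (and a b) (and (k * N) (or a b))"

lemma bit_opw:
  assumes "k < L" "c < 2"
  shows "bit (opw (mask L) c a b) k = (if c = 0 then bit a k \<and> bit b k else bit a k \<or> bit b k)"
  using assms by (cases "c = 0") (auto simp: opw_def bit_or_iff bit_and_iff bit_mask_iff less_2_cases_iff)

text \<open>Entry \<open>2 * \<alpha> + z\<close> is the value of the open piece at \<open>t\<close> under assignment \<open>\<alpha>\<close> and with \<open>z\<close>
  in its hole.\<close>

function tb :: "nat \<Rightarrow> (nat \<Rightarrow> nat) \<Rightarrow> nat \<Rightarrow> nat \<Rightarrow> nat" where
  "tb N yw t x =
     (if 2 \<le> tk t \<or> \<not> (0 < t \<and> l t < t) then
        (if is_X (tk t) then N * ((x div 2 + tk t) mod 2) else yw (tk t))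
      else if cut t then (if x = 0 then 0 else N)
      else opw N (tk t)
        (tb N yw (l t) (2 * (x div (2 * 2 ^ kk (t - 1))) + x mod 2))
        (tb N yw (t - 1) (x mod (2 * 2 ^ kk (t - 1)))))"
  by pat_completeness auto
termination by (relation "measure (\<lambda>(_, _, t, _). t)") auto

declare tb.simps [simp del]

lemma tb_leaf: "2 \<le> tk t \<Longrightarrow>
    tb N yw t x = (if is_X (tk t) then N * ((x div 2 + tk t) mod 2) else yw (tk t))"
  by (subst tb.simps) simp

lemma tb_op: "t < W \<Longrightarrow> tk t < 2 \<Longrightarrow> tb N yw t x =
    (if cut t then (if x = 0 then 0 else N)
     else opw N (tk t)
        (tb N yw (l t) (2 * (x div (2 * 2 ^ kk (t - 1))) + x mod 2))
        (tb N yw (t - 1) (x mod (2 * 2 ^ kk (t - 1)))))"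
  using op_pos[of t] l_less[of t] by (subst tb.simps) simp

text \<open>In an index \<open>2 * a + z\<close> the high bits of \<open>a\<close> belong to the
  left operand and the low bits to the right one. Both receive the same \<open>z\<close>, which
  matters to at most one of them.\<close>

lemma split_index:
  fixes a c z :: nat
  assumes "z < 2" "0 < c"
  shows "2 * ((2 * a + z) div (2 * c)) + (2 * a + z) mod 2 = 2 * (a div c) + z"
    and "(2 * a + z) mod (2 * c) = 2 * (a mod c) + z"
proof -
  have "(2 * a + z) div (2 * c) = a div c"
    using assms(1) by (simp add: div_mult2_eq)
  then show "2 * ((2 * a + z) div (2 * c)) + (2 * a + z) mod 2 = 2 * (a div c) + z"
    using assms(1) by simp
  show "(2 * a + z) mod (2 * c) = 2 * (a mod c) + z"
    using assms(1) by (simp add: mod_mult2_eq)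
qed

lemma tb_split:
  assumes "t < W" "tk t < 2" "\<not> cut t" "z < 2"
  shows "tb N yw t (2 * a + z) = opw N (tk t)
    (tb N yw (l t) (2 * (a div 2 ^ kk (t - 1)) + z))
    (tb N yw (t - 1) (2 * (a mod 2 ^ kk (t - 1)) + z))"
  using assms split_index[of z "2 ^ kk (t - 1)" a] by (simp add: tb_op)

text \<open>Only conjunctions and disjunctions lie between the hole and the root of its piece,
  because negation is confined to leaves.\<close>

lemma tb_mono:
  assumes "k < L"
  shows "t < W \<Longrightarrow> bit (tb (mask L) yw t (2 * a)) k \<Longrightarrow> bit (tb (mask L) yw t (2 * a + 1)) k"
proof (induction t arbitrary: a rule: less_induct)
  case (less t)
  show ?case
  proof (cases "tk t < 2")
    case True
    have lt: "l t < t" "0 < t" using True less(2) l_less op_pos by auto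
    show ?thesis
    proof (cases "cut t")
      case False
      have 0: "tb (mask L) yw t (2 * a) = opw (mask L) (tk t)
          (tb (mask L) yw (l t) (2 * (a div 2 ^ kk (t - 1))))
          (tb (mask L) yw (t - 1) (2 * (a mod 2 ^ kk (t - 1))))"
        using tb_split[of t 0 "mask L" yw a] True False less(2) by simp
      have 1: "tb (mask L) yw t (2 * a + 1) = opw (mask L) (tk t)
          (tb (mask L) yw (l t) (2 * (a div 2 ^ kk (t - 1)) + 1))
          (tb (mask L) yw (t - 1) (2 * (a mod 2 ^ kk (t - 1)) + 1))"
        using tb_split[of t 1 "mask L" yw a] True False less(2) by simp
      have "t - 1 < t" "t - 1 < W" "l t < W" using lt less(2) by auto
      note less(1)[OF lt(1) this(3)] less(1)[OF this(1,2)]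
      then show ?thesis
        using less(3) unfolding 0 1 bit_opw[OF assms True] by (auto split: if_splits)
    qed (use True less(2,3) in \<open>auto simp: tb_op split: if_splits\<close>)
  qed (use less(3) in \<open>auto simp: tb_leaf split: if_splits\<close>)
qed

text \<open>\<open>h\<close> is constrained only if there is a hole; for a piece without one, the
  claim for both values of \<open>h\<close> means that the two entries agree.\<close>

lemma bit_tb:
  assumes k: "k < L"
    and lvX: "\<And>t. t < W \<Longrightarrow> 2 \<le> tk t \<Longrightarrow> is_X (tk t) \<Longrightarrow>
      lv (tk t) = (xa (coord (tk t)) \<noteq> odd (tk t))"
    and lvY: "\<And>t. t < W \<Longrightarrow> 2 \<le> tk t \<Longrightarrow> \<not> is_X (tk t) \<Longrightarrow> bit (yw (tk t)) k = lv (tk t)"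
  shows "t < W \<Longrightarrow> (0 < ho t \<Longrightarrow> h = val tk lv (ho t)) \<Longrightarrow>
    bit (tb (mask L) yw t (2 * al xa t + of_bool h)) k = val tk lv t"
proof (induction t rule: less_induct)
  case (less t)
  show ?case
  proof (cases "tk t < 2")
    case True
    have "l t < t" "0 < t" using True less(2) l_less op_pos by auto
    then have lt: "l t < t" "0 < t" "t - 1 < t" "l t < W" "t - 1 < W" using less(2) by auto
    show ?thesis
    proof (cases "cut t")
      case c: True
      then have "h = val tk lv t" using less(2,3) True lt by (simp add: ho_op)
      then show ?thesis using c True less(2) k by (auto simp: tb_op al_op bit_mask_iff)
    next
      case False
      let ?c = "2 ^ kk (t - 1)"
      have a: "al xa t = al xa (l t) * ?c + al xa (t - 1)"
        using True False less(2) by (simp add: al_op)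
      have "al xa t div ?c = al xa (l t)" "al xa t mod ?c = al xa (t - 1)"
        unfolding a using al_less[OF lt(5)] by simp_all
      then have tb: "tb (mask L) yw t (2 * al xa t + of_bool h) = opw (mask L) (tk t)
          (tb (mask L) yw (l t) (2 * al xa (l t) + of_bool h))
          (tb (mask L) yw (t - 1) (2 * al xa (t - 1) + of_bool h))"
        using tb_split[of t "of_bool h" "mask L" yw "al xa t"] True False less(2) by simp
      have "ho t = ho (l t) + ho (t - 1)" "ho (l t) = 0 \<or> ho (t - 1) = 0"
        using False less(2) True by (simp add: ho_op) (use False in \<open>auto simp only: cut_def\<close>)
      then have "0 < ho (l t) \<Longrightarrow> h = val tk lv (ho (l t))"
        "0 < ho (t - 1) \<Longrightarrow> h = val tk lv (ho (t - 1))"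
        using less(3) by auto
      note less(1)[OF lt(1,4) this(1)] less(1)[OF lt(3,5) this(2)]
      then show ?thesis
        unfolding tb bit_opw[OF k True] using True lt by (simp add: val.simps[of _ _ t])
    qed
  next
    case False
    have v: "val tk lv t = lv (tk t)" using False by (simp add: val.simps)
    show ?thesis
    proof (cases "is_X (tk t)")
      case True
      then have "bit (tb (mask L) yw t (2 * al xa t + of_bool h)) k =
        odd (of_bool (xa (coord (tk t))) + tk t)"
        using False k by (auto simp: tb_leaf al_leaf bit_mask_iff mod2_eq_if)
      then show ?thesis using v lvX[OF less(2)] True False by auto
    next
      case f: False
      then show ?thesis using v lvY[OF less(2)] False by (simp add: tb_leaf)
    qed
  qed
qed

text \<open>A monotone function \<open>f\<close> of one bit \<open>h\<close> is \<open>f 0\<close>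
  or (\<open>f 1\<close> and \<open>h\<close>). This form works on whole words, where every bit
  position is another vector \<open>b\<close> with a hole value of its own. Without a hole
  \<open>sl 0\<close> is read, with no effect on the relevant bits as the two entries agree
  there.\<close>

definition piece :: "nat \<Rightarrow> (nat \<Rightarrow> nat) \<Rightarrow> (nat \<Rightarrow> bool) \<Rightarrow> (nat \<Rightarrow> nat) \<Rightarrow> nat \<Rightarrow> nat" where
  "piece N yw xa sl t = or (tb N yw t (2 * al xa t))
     (and (tb N yw t (2 * al xa t + 1)) (sl (ho t)))"

lemma bit_piece:
  assumes "k < L"
    and "\<And>t. t < W \<Longrightarrow> 2 \<le> tk t \<Longrightarrow> is_X (tk t) \<Longrightarrow>
      lv (tk t) = (xa (coord (tk t)) \<noteq> odd (tk t))"
    and "\<And>t. t < W \<Longrightarrow> 2 \<le> tk t \<Longrightarrow> \<not> is_X (tk t) \<Longrightarrow> bit (yw (tk t)) k = lv (tk t)"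
    and t: "t < W" and sl: "0 < ho t \<Longrightarrow> bit (sl (ho t)) k = val tk lv (ho t)"
  shows "bit (piece (mask L) yw xa sl t) k = val tk lv t"
proof -
  \<comment> \<open>Taking for \<open>h\<close> whatever the slot contains spares a separate
    treatment of pieces without a hole.\<close>
  define h where "h = bit (sl (ho t)) k"
  have "0 < ho t \<Longrightarrow> h = val tk lv (ho t)" using sl by (simp add: h_def)
  note bit_tb[where L = L and k = k and lv = lv and h = h, OF assms(1-3) t this]
  then show ?thesis using tb_mono[OF assms(1) t, of yw "al xa t"]
    by (cases h) (auto simp: piece_def bit_or_iff bit_and_iff h_def)
qed

end

section \<open>Program logic\<close>

text \<open>Safety, postcondition and time bound at a single start state; preconditions appear as
  assumptions on that state.\<close>

definition ok :: "nat list \<Rightarrow> nat \<Rightarrow> cmd \<Rightarrow> st \<Rightarrow> (st \<Rightarrow> bool) \<Rightarrow> nat \<Rightarrow> bool" where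
  "ok xs M c s Q T \<longleftrightarrow> safe xs M c s \<and> Q (exec xs c s) \<and> cost xs c s \<le> T"

lemma ok_seq:
  assumes "ok xs M c1 s R T1" "\<And>s'. R s' \<Longrightarrow> ok xs M c2 s' Q T2"
  shows "ok xs M (c1 ;; c2) s Q (T1 + T2)"
  using assms unfolding ok_def by (auto intro: add_mono)

lemma ok_asg:
  "safeE xs M e s \<Longrightarrow> ok xs M c (set_var v (eval xs e s) s) Q T \<Longrightarrow>
    ok xs M (Asg v e ;; c) s Q (sizeE e + 1 + T)"
  unfolding ok_def by simp

lemma ok_weaken:
  "ok xs M c s Q T \<Longrightarrow> (\<And>s'. Q s' \<Longrightarrow> Q' s') \<Longrightarrow> T \<le> T' \<Longrightarrow> ok xs M c s Q' T'"
  unfolding ok_def by auto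

lemma ok_if:
  assumes "safeE xs M a s" "safeE xs M b s"
    and "eval xs a s < eval xs b s \<Longrightarrow> ok xs M c1 s Q T"
    and "\<not> eval xs a s < eval xs b s \<Longrightarrow> ok xs M c2 s Q T"
  shows "ok xs M (IfLess a b c1 c2) s Q (sizeE a + sizeE b + 2 + T)"
  using assms unfolding ok_def by (cases "eval xs a s < eval xs b s") auto

lemma ok_for:
  assumes "safeE xs M e s" "eval xs e s = k" "k < M" "I 0 s"
    and body: "\<And>i s. i < k \<Longrightarrow> I i s \<Longrightarrow> ok xs M c (set_var v i s) (I (Suc i)) T"
  shows "ok xs M (For v e c) s (I k) (sizeE e + 3 + k * (T + 5))"
proof -
  have inv: "I i (iter v (exec xs c) i s)" if "i \<le> k" for i
    using that by (induction i) (use assms(4) body in \<open>auto simp: ok_def\<close>)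
  have "safe xs M c (set_var v i (iter v (exec xs c) i s)) \<and>
      cost xs c (set_var v i (iter v (exec xs c) i s)) \<le> T" if "i < k" for i
    using body[OF that inv] that by (simp add: ok_def)
  moreover from this have
    "(\<Sum>i < k. cost xs c (set_var v i (iter v (exec xs c) i s)) + 5) \<le> (\<Sum>i < k. T + 5)"
    by (intro sum_mono) auto
  ultimately show ?thesis using assms inv[of k] by (simp add: ok_def)
qed

section \<open>The program\<close>

abbreviation (input) add (infixl "\<^bold>+" 65) where "a \<^bold>+ b \<equiv> Bin Add a b"
abbreviation (input) sub (infixl "\<^bold>-" 65) where "a \<^bold>- b \<equiv> Bin Sub a b"
abbreviation (input) mul (infixl "\<^bold>*" 70) where "a \<^bold>* b \<equiv> Bin Mul a b"
abbreviation (input) quo (infixl "\<^bold>'/" 70) where "a \<^bold>/ b \<equiv> Bin Div a b"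
abbreviation (input) rem (infixl "\<^bold>%" 70) where "a \<^bold>% b \<equiv> Bin Mod a b"
abbreviation (input) bitand (infixl "\<^bold>&" 62) where "a \<^bold>& b \<equiv> Bin BitAnd a b"
abbreviation (input) bitor (infixl "\<^bold>|" 61) where "a \<^bold>| b \<equiv> Bin BitOr a b"
abbreviation (input) shl (infixl "\<lless>" 63) where "a \<lless> b \<equiv> Bin Shl a b"
abbreviation (input) asg (infix "::=" 61) where "v ::= e \<equiv> Asg v e"

text \<open>The arrays \<open>aLC\<close>, \<open>aKK\<close>, \<open>aHO\<close> and \<open>aEV\<close> hold \<open>lc\<close>, \<open>kk\<close>, \<open>ho\<close> and \<open>evs\<close>; \<open>aST\<close> is the
  parsing stack; \<open>aAL\<close> holds \<open>al\<close> for all \<open>a\<close>; for the current batch, \<open>aTB\<close> holds \<open>tb\<close> and \<open>aSL\<close>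
  the values of the cut tokens.\<close>

abbreviation (input) "vres \<equiv> 0 :: nat"
abbreviation (input) "vn \<equiv> 2 :: nat"
abbreviation (input) "vm \<equiv> 3 :: nat"
abbreviation (input) "vW \<equiv> 4 :: nat"
abbreviation (input) "vL \<equiv> 5 :: nat"
abbreviation (input) "vp \<equiv> 6 :: nat"
abbreviation (input) "vN \<equiv> 7 :: nat"
abbreviation (input) "vs \<equiv> 8 :: nat"
abbreviation (input) "vD \<equiv> 9 :: nat"
abbreviation (input) "vA \<equiv> 10 :: nat"
abbreviation (input) "vB \<equiv> 11 :: nat"
abbreviation (input) "vE \<equiv> 12 :: nat"
abbreviation (input) "vsp \<equiv> 13 :: nat"
abbreviation (input) "vt \<equiv> 14 :: nat"
abbreviation (input) "vtok \<equiv> 15 :: nat"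
abbreviation (input) "vl \<equiv> 16 :: nat"
abbreviation (input) "vz \<equiv> 17 :: nat"
abbreviation (input) "vf \<equiv> 18 :: nat"
abbreviation (input) "vi \<equiv> 19 :: nat"
abbreviation (input) "vx \<equiv> 20 :: nat"
abbreviation (input) "vy \<equiv> 21 :: nat"
abbreviation (input) "vj \<equiv> 22 :: nat"
abbreviation (input) "vst \<equiv> 23 :: nat"
abbreviation (input) "ve \<equiv> 24 :: nat"
abbreviation (input) "vu \<equiv> 25 :: nat"
abbreviation (input) "vv \<equiv> 26 :: nat"
abbreviation (input) "vk \<equiv> 27 :: nat"
abbreviation (input) "vb \<equiv> 28 :: nat"
abbreviation (input) "vc \<equiv> 29 :: nat"

abbreviation (input) "aLC \<equiv> 0 :: nat"
abbreviation (input) "aKK \<equiv> 2 :: nat"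
abbreviation (input) "aHO \<equiv> 3 :: nat"
abbreviation (input) "aEV \<equiv> 4 :: nat"
abbreviation (input) "aSL \<equiv> 5 :: nat"
abbreviation (input) "aST \<equiv> 6 :: nat"
abbreviation (input) "aAL \<equiv> 7 :: nat"
abbreviation (input) "aTB \<equiv> 8 :: nat"

text \<open>There is no logarithm instruction: \<open>vp\<close> is doubled as long as its double is
  at most \<open>n\<close>, and \<open>vL\<close> counts the doublings. The offset \<open>vA\<close>
  skips the two header words and the \<open>vW\<close> tokens.\<close>

definition prog_init :: cmd where
  "prog_init =
    vn ::= Inp (Lit 0) ;; vm ::= Inp (Lit 1) ;; vW ::= Lit 4 \<^bold>* Var vm \<^bold>- Lit 1 ;;
    vp ::= Lit 1 ;; vL ::= Lit 0 ;;
    For vi (Var vn) (IfLess (Var vn) (Var vp \<^bold>+ Var vp) Skip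
      (vp ::= Var vp \<^bold>+ Var vp ;; vL ::= Var vL \<^bold>+ Lit 1)) ;;
    vN ::= Var vp \<^bold>- Lit 1 ;; vs ::= Var vL \<^bold>/ Lit 4 \<^bold>+ Lit 1 ;; vD ::= Lit 2 \<lless> Var vs ;;
    vA ::= Var vW \<^bold>+ Lit 2 ;; vB ::= Var vA \<^bold>+ Var vn \<^bold>* Var vm"

text \<open>Once both operands are popped, the left one is the entry at the stack pointer; the right
  one is \<open>t - 1\<close> and is not looked up. \<open>vf\<close> collects the two reasons for a
  cut.\<close>

definition body_parse :: cmd where
  "body_parse =
    vtok ::= Inp (Var vt \<^bold>+ Lit 2) ;;
    IfLess (Var vtok) (Lit 2)
      (vsp ::= Var vsp \<^bold>- Lit 2 ;; vl ::= Ld aST (Var vsp) ;; St aLC (Var vt) (Var vl) ;;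
       vz ::= Ld aKK (Var vl) \<^bold>+ Ld aKK (Var vt \<^bold>- Lit 1) ;; vf ::= Lit 0 ;;
       IfLess (Var vs) (Var vz) (vf ::= Lit 1) Skip ;;
       IfLess (Lit 0) (Ld aHO (Var vl))
         (IfLess (Lit 0) (Ld aHO (Var vt \<^bold>- Lit 1)) (vf ::= Lit 1) Skip) Skip ;;
       IfLess (Lit 0) (Var vf)
         (St aKK (Var vt) (Lit 0) ;; St aHO (Var vt) (Var vt) ;;
          St aEV (Var vE) (Var vt) ;; vE ::= Var vE \<^bold>+ Lit 1)
         (St aKK (Var vt) (Var vz) ;;
          St aHO (Var vt) (Ld aHO (Var vl) \<^bold>+ Ld aHO (Var vt \<^bold>- Lit 1))))
      (IfLess ((Var vtok \<^bold>- Lit 2) \<^bold>% Lit 4) (Lit 2)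
         (St aKK (Var vt) (Lit 1)) (St aKK (Var vt) (Lit 0)) ;;
       St aHO (Var vt) (Lit 0)) ;;
    St aST (Var vsp) (Var vt) ;; vsp ::= Var vsp \<^bold>+ Lit 1"

definition prog_parse :: cmd where
  "prog_parse = vsp ::= Lit 0 ;; vE ::= Lit 0 ;; For vt (Var vW) body_parse"

definition body_alpha :: cmd where
  "body_alpha =
    vtok ::= Inp (Var vt \<^bold>+ Lit 2) ;; vb ::= Var vi \<^bold>* Var vW ;;
    IfLess (Var vtok) (Lit 2)
      (IfLess (Ld aHO (Var vt)) (Var vt)
        (St aAL (Var vb \<^bold>+ Var vt)
          ((Ld aAL (Var vb \<^bold>+ Ld aLC (Var vt)) \<lless> Ld aKK (Var vt \<^bold>- Lit 1))
            \<^bold>+ Ld aAL (Var vb \<^bold>+ (Var vt \<^bold>- Lit 1))))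
        (St aAL (Var vb \<^bold>+ Var vt) (Lit 0)))
      (IfLess ((Var vtok \<^bold>- Lit 2) \<^bold>% Lit 4) (Lit 2)
        (St aAL (Var vb \<^bold>+ Var vt)
          (Inp (Var vA \<^bold>+ Var vi \<^bold>* Var vm \<^bold>+ (Var vtok \<^bold>- Lit 2) \<^bold>/ Lit 4)))
        (St aAL (Var vb \<^bold>+ Var vt) (Lit 0)))"

definition prog_alpha :: cmd where
  "prog_alpha = For vi (Var vn) (For vt (Var vW) body_alpha)"

definition body_merge :: cmd where
  "body_merge =
    vu ::= Ld aTB (Var vl \<^bold>* Var vD \<^bold>+ (Lit 2 \<^bold>* (Var vx \<^bold>/ Var vc) \<^bold>+ Var vx \<^bold>% Lit 2)) ;;
    vv ::= Ld aTB (Var vz \<^bold>+ Var vx \<^bold>% Var vc) ;;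
    St aTB (Var vb \<^bold>+ Var vx) ((Var vu \<^bold>& Var vv) \<^bold>| ((Var vtok \<^bold>* Var vN) \<^bold>& (Var vu \<^bold>| Var vv)))"

text \<open>Bit \<open>k\<close> belongs to the \<open>k\<close>-th vector of the batch. Gathering
  the word of a Y-leaf takes time O(L), but it is paid once per batch and not once per vector of
  A.\<close>

definition body_word :: cmd where
  "body_word = vy ::= (Var vy \<^bold>|
    (Inp (Var vB \<^bold>+ (Var vst \<^bold>+ Var vk) \<^bold>* Var vm \<^bold>+ (Var vtok \<^bold>- Lit 2) \<^bold>/ Lit 4) \<lless> Var vk))"

definition body_table :: cmd where
  "body_table =
    vtok ::= Inp (Var vt \<^bold>+ Lit 2) ;; vb ::= Var vt \<^bold>* Var vD ;;
    IfLess (Var vtok) (Lit 2)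
      (IfLess (Ld aHO (Var vt)) (Var vt)
        (vl ::= Ld aLC (Var vt) ;; vz ::= (Var vt \<^bold>- Lit 1) \<^bold>* Var vD ;;
         vc ::= (Lit 2 \<lless> Ld aKK (Var vt \<^bold>- Lit 1)) ;;
         For vx (Lit 2 \<lless> Ld aKK (Var vt)) body_merge)
        (St aTB (Var vb) (Lit 0) ;; St aTB (Var vb \<^bold>+ Lit 1) (Var vN)))
      (IfLess ((Var vtok \<^bold>- Lit 2) \<^bold>% Lit 4) (Lit 2)
        (For vx (Lit 4) (St aTB (Var vb \<^bold>+ Var vx)
          (Var vN \<^bold>* ((Var vx \<^bold>/ Lit 2 \<^bold>+ Var vtok) \<^bold>% Lit 2))))
        (vy ::= Lit 0 ;; For vk (Var vL) body_word ;;
         IfLess (Lit 0) (Var vtok \<^bold>% Lit 2) (vy ::= Bin BitXor (Var vy) (Var vN)) Skip ;;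
         St aTB (Var vb) (Var vy) ;; St aTB (Var vb \<^bold>+ Lit 1) (Var vy)))"

definition prog_table :: cmd where
  "prog_table = For vt (Var vW) body_table"

definition prog_piece :: "nat \<Rightarrow> nat \<Rightarrow> cmd" where
  "prog_piece u t =
    vb ::= Var t \<^bold>* Var vD \<^bold>+ Lit 2 \<^bold>* Ld aAL (Var vi \<^bold>* Var vW \<^bold>+ Var t) ;;
    u ::= (Ld aTB (Var vb) \<^bold>| (Ld aTB (Var vb \<^bold>+ Lit 1) \<^bold>& Ld aSL (Ld aHO (Var t))))"

text \<open>The open piece at a cut token is a bare hole, so the value to store is the gate applied
  to the closed pieces of its two operands. Cut tokens come in increasing order, hence the holes of
  these pieces have been filled before.\<close>

definition body_event :: cmd where
  "body_event =
    vt ::= Ld aEV (Var ve) ;; vtok ::= Inp (Var vt \<^bold>+ Lit 2) ;;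
    vl ::= Ld aLC (Var vt) ;; vz ::= Var vt \<^bold>- Lit 1 ;;
    prog_piece vu vl ;; prog_piece vv vz ;;
    St aSL (Var vt) ((Var vu \<^bold>& Var vv) \<^bold>| ((Var vtok \<^bold>* Var vN) \<^bold>& (Var vu \<^bold>| Var vv)))"

definition body_query :: cmd where
  "body_query =
    For ve (Var vE) body_event ;;
    vz ::= Var vW \<^bold>- Lit 1 ;; prog_piece vu vz ;;
    IfLess (Lit 0) (Var vu \<^bold>& Var vN) (vres ::= Lit 1) Skip"

text \<open>The last batches start at \<open>n - L\<close>, overlapping the others, so that no padding is needed.\<close>

definition body_batch :: cmd where
  "body_batch =
    vst ::= Var vj \<^bold>* Var vL ;;
    IfLess (Var vn \<^bold>- Var vL) (Var vst) (vst ::= Var vn \<^bold>- Var vL) Skip ;;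
    prog_table ;; For vi (Var vn) body_query"

definition prog :: cmd where
  "prog = prog_init ;; prog_parse ;; prog_alpha ;;
    For vj (Var vn \<^bold>/ Var vL \<^bold>+ Lit 1) body_batch"

lemmas prog_defs = prog_def prog_init_def prog_parse_def body_parse_def prog_alpha_def
  body_alpha_def body_batch_def prog_table_def body_table_def body_merge_def body_word_def
  body_query_def body_event_def prog_piece_def

lemma well_formed_prog: "well_formed 30 prog"
  by (simp add: prog_defs num_arrays_def)

section \<open>Correctness\<close>

primrec wd :: "nat \<Rightarrow> (nat \<Rightarrow> bool) \<Rightarrow> nat" where
  "wd 0 f = 0"
| "wd (Suc k) f = or (wd k f) (of_bool (f k) * 2 ^ k)"

lemma bit_wd: "bit (wd k f) j \<longleftrightarrow> j < k \<and> f j"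
  by (induction k) (auto simp: bit_or_iff bit_exp_iff less_Suc_eq)

text \<open>Separates the program from the encoding: only positions in the input and the postfix
  structure are assumed. The two powers of two enclosing \<open>n\<close> make \<open>L\<close> the
  binary logarithm of \<open>n\<close>, rounded down.\<close>

locale inst =
  fixes xs :: "nat list" and n m L :: nat and tk :: "nat \<Rightarrow> nat" and A B :: "nat \<Rightarrow> nat \<Rightarrow> bool"
  assumes n2: "2 \<le> n" and m1: "1 \<le> m" and L_le: "2 ^ L \<le> n" and L_less: "n < 2 * 2 ^ L"
    and inp0: "xs ! 0 = n" and inp1: "xs ! 1 = m"
    and tok: "t < 4 * m - 1 \<Longrightarrow> xs ! (t + 2) = tk t"
    and inpA: "i < n \<Longrightarrow> j < m \<Longrightarrow> xs ! (4 * m + 1 + i * m + j) = of_bool (A i j)"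
    and inpB: "i < n \<Longrightarrow> j < m \<Longrightarrow> xs ! (4 * m + 1 + n * m + i * m + j) = of_bool (B i j)"
    and length_xs: "length xs = 4 * m + 1 + 2 * n * m"
    and coord_less: "t < 4 * m - 1 \<Longrightarrow> 2 \<le> tk t \<Longrightarrow> coord (tk t) < m"
    and wf_tok: "t < 4 * m - 1 \<Longrightarrow> tk t < 2 \<Longrightarrow> wf_tokens tk t"
begin

definition W where "W = 4 * m - 1"
definition s where "s = L div 4 + 1"
definition D :: nat where "D = 2 * 2 ^ s"
text \<open>The largest index range is that of the tables, \<open>W * D\<close>, which is at most
  \<open>16 * (n * m)\<close>; the factor 64 leaves room for all other quantities.\<close>

definition M where "M = 64 * (n * m)"

sublocale pieces tk W s
  by unfold_locales (use wf_tok in \<open>auto simp: W_def s_def\<close>)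

lemma L_pos: "0 < L"
  using n2 L_less by (cases L) auto

lemma L_less_n: "L < n"
  using L_le less_exp[of L] by (meson order_less_le_trans)

text \<open>A crude bound that suffices for indices; the running time rests on
  \<open>D_L_le\<close>.\<close>

lemma s_exp: "2 ^ s \<le> 2 * n"
proof -
  have "(2::nat) ^ (L div 4) \<le> 2 ^ L" by (intro power_increasing) auto
  then have "(2::nat) ^ (L div 4) \<le> n" using L_le by (rule order_trans)
  then show ?thesis by (simp add: s_def)
qed

lemma D_le: "D \<le> 4 * n"
  using s_exp by (simp add: D_def)

lemma D_ge: "4 \<le> D"
  by (simp add: D_def s_def)

lemma nm: "n \<le> n * m" "2 * m \<le> n * m" "2 \<le> n * m"
proof -
  show 1: "n \<le> n * m" using m1 by (cases m) auto
  show "2 * m \<le> n * m" using n2 by (intro mult_le_mono1)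
  show "2 \<le> n * m" using 1 n2 by linarith
qed

lemma W_bounds: "W + 1 = 4 * m" "0 < W" "W + 1 \<le> 2 * (n * m)"
  using m1 nm by (auto simp: W_def)

lemma s_le: "s \<le> L" "s \<le> n"
  using L_pos L_less_n by (auto simp: s_def)

lemma small_less_M:
  "x \<le> 8 \<Longrightarrow> x < M" "t \<le> W \<Longrightarrow> t + 2 < M" "i \<le> n \<Longrightarrow> i + n + 2 < M" "4 * m < M"
  unfolding M_def using nm W_bounds by linarith+

lemma AL_less:
  assumes "i < n" "t < W"
  shows "i * W + t < M"
proof -
  have "i * W + t < n * W"
    using assms mult_le_mono1[of "i + 1" n W] by simp
  also have "\<dots> \<le> n * (4 * m)" using W_bounds by (intro mult_le_mono2) simp
  also have "\<dots> \<le> M" by (simp add: M_def)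
  finally show ?thesis .
qed

lemma TB_less:
  assumes "t < W" "x < D"
  shows "t * D + x < M"
proof -
  have "t * D + x < W * D" using assms mult_le_mono1[of "t + 1" W D] by simp
  also have "\<dots> \<le> (4 * m) * (4 * n)" using W_bounds D_le by (intro mult_le_mono) simp_all
  also have "\<dots> \<le> M" by (simp add: M_def)
  finally show ?thesis .
qed

lemma AL_eq: "t < W \<Longrightarrow> t' < W \<Longrightarrow> i * W + t = i' * W + t' \<longleftrightarrow> i = i' \<and> t = t'"
  for i i' t t' :: nat
proof -
  assume "t < W" "t' < W"
  then have "(i * W + t) div W = i" "(i' * W + t') div W = i'" by simp_all
  then show ?thesis by (metis add_left_cancel)
qed

lemma TB_eq: "x < D \<Longrightarrow> x' < D \<Longrightarrow> t * D + x = t' * D + x' \<longleftrightarrow> t = t' \<and> x = x'"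
  for t t' x x' :: nat
proof -
  assume "x < D" "x' < D"
  then have "(t * D + x) div D = t" "(t' * D + x') div D = t'" by simp_all
  then show ?thesis by (metis add_left_cancel)
qed

lemma kk_D: "t < W \<Longrightarrow> 2 * 2 ^ kk t \<le> D"
  unfolding D_def by (simp add: kk_le)

definition G :: "nat \<Rightarrow> st \<Rightarrow> bool" where
  "G r s' \<longleftrightarrow> vars s' vres = r \<and> vars s' vn = n \<and> vars s' vm = m \<and> vars s' vW = W \<and>
     vars s' vL = L \<and> vars s' vN = mask L \<and> vars s' vs = s \<and> vars s' vD = D \<and>
     vars s' vA = 4 * m + 1 \<and> vars s' vB = 4 * m + 1 + n * m"

lemma prog_init_ok:
  "ok xs M prog_init \<lparr>vars = \<lambda>_. 0, arr = \<lambda>_ _. 0\<rparr> (G 0) (60 + 30 * n)"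
proof -
  \<comment> \<open>Either the doubling has come to an end, or every round so far has doubled and
    \<open>vL\<close> is the number of rounds.\<close>
  let ?I = "\<lambda>i (s' :: st). vars s' vres = 0 \<and> vars s' vn = n \<and> vars s' vm = m \<and> vars s' vW = W \<and>
    vars s' vp = 2 ^ vars s' vL \<and> vars s' vp \<le> n \<and> (n < 2 * vars s' vp \<or> vars s' vL = i)"
  let ?c = "IfLess (Var vn) (Var vp \<^bold>+ Var vp) Skip
      (vp ::= Var vp \<^bold>+ Var vp ;; vL ::= Var vL \<^bold>+ Lit 1)"
  have loop: "ok xs M (For vi (Var vn) ?c) s0 (?I n) (sizeE (Var vn) + 3 + n * (20 + 5))"
    if "?I 0 s0" for s0
  proof (rule ok_for[where I = ?I])
    fix i s1 assume "i < n" "?I i s1"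
    moreover have "vars s1 vL < vars s1 vp" using \<open>?I i s1\<close> by simp
    ultimately have less: "vars s1 vp + vars s1 vp < M" "vars s1 vL + 1 < M" "1 < M"
      using nm unfolding M_def by linarith+
    then show "ok xs M ?c (set_var vi i s1) (?I (Suc i)) 20"
      using \<open>?I i s1\<close> by (auto simp: ok_def)
  qed (use that small_less_M(3)[of n] in auto)
  have p: "a = L" if "2 ^ a \<le> n" "n < 2 * 2 ^ a" for a :: nat
  proof -
    have 1: "(2::nat) ^ a < 2 ^ Suc L" and 2: "(2::nat) ^ L < 2 ^ Suc a"
      using that L_le L_less by simp_all
    have "a < Suc L" by (rule power_less_imp_less_exp[OF _ 1]) simp
    moreover have "L < Suc a" by (rule power_less_imp_less_exp[OF _ 2]) simp
    ultimately show ?thesis by simp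
  qed
  have rest: "ok xs M (vN ::= Var vp \<^bold>- Lit 1 ;; vs ::= Var vL \<^bold>/ Lit 4 \<^bold>+ Lit 1 ;;
    vD ::= Lit 2 \<lless> Var vs ;; vA ::= Var vW \<^bold>+ Lit 2 ;;
    vB ::= Var vA \<^bold>+ Var vn \<^bold>* Var vm) s0 (G 0) 40" if "?I n s0" for s0
  proof -
    \<comment> \<open>If all \<open>n\<close> rounds had doubled, \<open>2 ^ n \<le> n\<close> would
      follow.\<close>
    have "vars s0 vL \<noteq> n" using that less_exp[of "vars s0 vL"] by linarith
    then have "vars s0 vL = L" using that p by simp
    then have v: "vars s0 vL = L" "vars s0 vp = 2 ^ L" "vars s0 vres = 0" "vars s0 vn = n"
      "vars s0 vm = m" "vars s0 vW = W" using that by simp_all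
    have b: "s < M" "2 * 2 ^ s < M" "Suc (4 * m + n * m) < M" "n < M" "n * m < M" "2 ^ L < M"
      using s_le D_le nm L_le unfolding M_def D_def by linarith+
    have e: "Suc (L div 4) = s" "Suc (Suc W) = Suc (4 * m)" "2 ^ L - Suc 0 = mask L" "D = 2 * 2 ^ s"
      using W_bounds by (simp_all add: s_def mask_eq_exp_minus_1 D_def)
    have c: "0 < M" "1 < M" "2 < M" "4 < M" "4 * m < M" "Suc (4 * m) < M"
      using small_less_M(1)[of 4] small_less_M(4) b(3) by linarith+
    have "2 ^ L - Suc 0 < M" using b by simp
    then show ?thesis
      using v b e(1,2,4) c by (simp add: ok_def G_def e(3))
  qed
  show ?thesis
    unfolding prog_init_def
    apply (rule ok_weaken)
      apply (rule ok_asg[rotated])+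
          apply (rule ok_seq[OF loop])
           prefer 2
           apply (rule rest)
           apply assumption
    using m1 small_less_M W_bounds length_xs inp0 inp1 n2
    by (auto simp: W_def)
qed

section \<open>Parsing the formula\<close>

lemma length_stk_le: "length (stk tk t) \<le> t"
  by (induction t) auto

lemma length_evs_le: "length (evs t) \<le> t"
  by (induction t) (auto simp: evs_Suc)

definition parsed :: "nat \<Rightarrow> st \<Rightarrow> bool" where
  "parsed t s' \<longleftrightarrow> vars s' vE = length (evs t) \<and>
     (\<forall>e < length (evs t). arr s' aEV e = evs t ! e) \<and>
     (\<forall>u < t. arr s' aKK u = kk u \<and> arr s' aHO u = ho u \<and> (tk u < 2 \<longrightarrow> arr s' aLC u = l u))"

text \<open>The array holds the stack bottom first, hence \<open>rev\<close>.\<close>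

definition inv_parse :: "nat \<Rightarrow> st \<Rightarrow> bool" where
  "inv_parse t s' \<longleftrightarrow> G 0 s' \<and> parsed t s' \<and> vars s' vsp = length (stk tk t) \<and>
     (\<forall>i < length (stk tk t). arr s' aST i = rev (stk tk t) ! i)"

lemma tok_W: "t < W \<Longrightarrow> xs ! (t + 2) = tk t" "t < W \<Longrightarrow> t + 2 < length xs"
  using tok length_xs by (auto simp: W_def)

lemma tok_less_M: "t < W \<Longrightarrow> tk t - 2 < M"
proof (cases "2 \<le> tk t")
  case True
  assume "t < W"
  then have "(tk t - 2) div 4 < m" using coord_less True by (simp add: W_def coord_def)
  then have "tk t - 2 < 4 * m" by linarith
  then show ?thesis using small_less_M(4) by simp
qed (use small_less_M in auto)

lemma body_parse_ok:
  assumes t: "t < W" and inv: "inv_parse t s0"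
  shows "ok xs M body_parse (set_var vt t s0) (inv_parse (Suc t)) 200"
proof -
  have g: "vars s0 vres = 0" "vars s0 vn = n" "vars s0 vm = m" "vars s0 vW = W"
     "vars s0 vL = L" "vars s0 vN = mask L" "vars s0 vs = s" "vars s0 vD = D"
     "vars s0 vA = 4 * m + 1" "vars s0 vB = 4 * m + 1 + n * m"
    and p: "vars s0 vE = length (evs t)" "\<forall>e < length (evs t). arr s0 aEV e = evs t ! e"
     "\<forall>u < t. arr s0 aKK u = kk u" "\<forall>u < t. arr s0 aHO u = ho u"
     "\<forall>u < t. tk u < 2 \<longrightarrow> arr s0 aLC u = l u"
    and st: "vars s0 vsp = length (stk tk t)"
     "\<And>i. i < length (stk tk t) \<Longrightarrow> arr s0 aST i = rev (stk tk t) ! i"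
    using inv unfolding inv_parse_def G_def parsed_def by simp_all
  have M: "t < M" "t + 2 < M" "Suc (length (evs t)) < M" "1 < M" "2 < M" "0 < M" "4 < M"
    using small_less_M(1)[of 4] small_less_M(2)[of t] t length_evs_le[of t] by simp_all
  note tk = tok_W[OF t]
  show ?thesis
  proof (cases "tk t < 2")
    case True
    have lt: "l t < t" "t - 1 < t" "0 < t" using True t l_less op_pos[of t] by auto
    define r where "r = drop 2 (stk tk t)"
    have stk: "stk tk t = (t - 1) # l t # r" using stk_op[OF t True] by (simp add: r_def)
    have st1: "\<forall>i < length r. arr s0 aST i = rev r ! i" "arr s0 aST (length r) = l t"
      using st(2) by (auto simp: stk nth_append)
    have k: "arr s0 aKK (l t) = kk (l t)" "arr s0 aKK (t - 1) = kk (t - 1)"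
      "arr s0 aHO (l t) = ho (l t)" "arr s0 aHO (t - 1) = ho (t - 1)"
      using p lt by auto
    have "kk (l t) \<le> s" "kk (t - 1) \<le> s" using lt t kk_le by simp_all
    then have kM: "kk (l t) + kk (t - 1) < M"
      using s_le nm unfolding M_def by linarith
    have "t - 1 < W" "l t < W" using lt t by simp_all
    then have "ho (l t) \<le> t" "ho (t - 1) \<le> t"
      using ho_le[of "l t"] ho_le[of "t - 1"] lt t by linarith+
    then have hM: "ho (l t) + ho (t - 1) < M"
      using t W_bounds nm unfolding M_def by linarith
    have rM: "length r + 1 < M" "length r + 2 \<le> t" "length r < M"
      using length_stk_le[of t] M(2) by (simp_all add: stk)
    note kt = kk_op[OF t True, unfolded cut_def] ho_op[OF t True, unfolded cut_def]
    have stkS: "stk tk (Suc t) = t # r" using True by (simp add: stk)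
    have spv: "vars s0 vsp = Suc (Suc (length r))" using st(1) by (simp add: stk)
    note facts = g p st1 k kM hM rM kt stkS spv M tk lt True evs_Suc[of t, unfolded cut_def]
    show ?thesis
      by (cases "s < kk (l t) + kk (t - 1)"; cases "0 < ho (l t)"; cases "0 < ho (t - 1)")
        (use facts in \<open>simp_all add: ok_def body_parse_def inv_parse_def G_def parsed_def
          less_Suc_eq nth_append all_conj_distrib imp_conjL\<close>)
  next
    case False
    have stkS: "stk tk (Suc t) = t # stk tk t" using False by simp
    have kt: "kk t = of_bool ((tk t - 2) mod 4 < 2)" "ho t = 0"
      using False by (simp_all add: kk_leaf ho_leaf is_X_def)
    have rM: "Suc (length (stk tk t)) < M" using length_stk_le[of t] M(2) by simp
    note facts = g p st rM kt stkS M tk False evs_Suc[of t] tok_less_M[OF t]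
    show ?thesis
      by (cases "(tk t - 2) mod 4 < 2")
        (use facts in \<open>simp_all add: ok_def body_parse_def inv_parse_def G_def parsed_def
          less_Suc_eq nth_append all_conj_distrib imp_conjL\<close>)
  qed
qed

lemma prog_parse_ok:
  assumes "G 0 s0"
  shows "ok xs M prog_parse s0 (\<lambda>s'. G 0 s' \<and> parsed W s') (10 + 205 * W)"
  unfolding prog_parse_def
  apply (rule ok_weaken)
    apply (rule ok_asg[rotated])+
      apply (rule ok_for[where I = inv_parse and k = W])
          prefer 5
          apply (rule body_parse_ok)
           apply assumption+
  using assms small_less_M(2)[of W] small_less_M(1)[of 0]
  by (auto simp: inv_parse_def G_def parsed_def)

section \<open>Restricted X-assignments of the vectors of A\<close>

lemma G_vars:
  assumes "G r s'"
  shows "vars s' vres = r" "vars s' vn = n" "vars s' vm = m" "vars s' vW = W" "vars s' vL = L"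
    "vars s' vN = mask L" "vars s' vs = s" "vars s' vD = D" "vars s' vA = 4 * m + 1"
    "vars s' vB = 4 * m + 1 + n * m"
  using assms by (simp_all add: G_def)

text \<open>Progress of the two nested loops in lexicographic order; \<open>alphas n 0\<close> says
  that everything is filled in.\<close>

definition alphas :: "nat \<Rightarrow> nat \<Rightarrow> st \<Rightarrow> bool" where
  "alphas i t s' \<longleftrightarrow> (\<forall>j u. u < W \<longrightarrow> j < i \<or> j = i \<and> u < t \<longrightarrow> arr s' aAL (j * W + u) = al (A j) u)"

lemma al_less_M: "t < W \<Longrightarrow> al xa t < M"
proof -
  assume t: "t < W"
  have "(2::nat) ^ kk t \<le> 2 ^ s" using kk_le[OF t] by simp
  then show ?thesis using al_less[OF t, of xa] s_exp nm unfolding M_def by linarith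
qed

lemma inp_less:
  assumes "i < n" "j < m"
  shows "4 * m + 1 + i * m + j < length xs" "4 * m + 1 + n * m + i * m + j < length xs"
    "4 * m + 1 + n * m + i * m + j < M" "4 * m + 1 + i * m + j < M"
proof -
  have "i * m + j < n * m" using assms mult_le_mono1[of "i + 1" n m] by simp
  then show "4 * m + 1 + i * m + j < length xs" "4 * m + 1 + n * m + i * m + j < length xs"
    "4 * m + 1 + n * m + i * m + j < M" "4 * m + 1 + i * m + j < M"
    using nm unfolding length_xs M_def by linarith+
qed

lemma body_alpha_ok:
  assumes t: "t < W" and i: "i < n"
    and inv: "G r s0" "parsed W s0" "alphas i t s0" "vars s0 vi = i"
  shows "ok xs M body_alpha (set_var vt t s0)
    (\<lambda>s'. G r s' \<and> parsed W s' \<and> alphas i (Suc t) s' \<and> vars s' vi = i) 200"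
proof -
  note g = G_vars[OF inv(1)]
  have p: "vars s0 vE = length (evs W)" "\<forall>e < length (evs W). arr s0 aEV e = evs W ! e"
     "\<forall>u < W. arr s0 aKK u = kk u" "\<forall>u < W. arr s0 aHO u = ho u"
     "\<forall>u < W. tk u < 2 \<longrightarrow> arr s0 aLC u = l u"
    using inv(2) unfolding parsed_def by simp_all
  have a: "\<And>j u. u < W \<Longrightarrow> j < i \<or> j = i \<and> u < t \<Longrightarrow> arr s0 aAL (j * W + u) = al (A j) u"
    using inv(3) unfolding alphas_def by blast
  have M: "t < M" "t + 2 < M" "1 < M" "2 < M" "0 < M" "4 < M" "i * W + t < M" "i * W < M"
    using small_less_M(1)[of 4] small_less_M(2)[of t] AL_less[OF i t] t by simp_all
  note tk = tok_W[OF t]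
  have upd: "(\<forall>j u. u < W \<longrightarrow> j < i \<or> j = i \<and> u < Suc t \<longrightarrow>
      ((arr s0 aAL)(i * W + t := x)) (j * W + u) = al (A j) u)" if "x = al (A i) t" for x
    using a AL_eq t that by (auto simp: less_Suc_eq)
  show ?thesis
  proof (cases "tk t < 2")
    case True
    have lt: "l t < t" "0 < t" using True t l_less op_pos[of t] by auto
    then obtain r' where r': "t = Suc r'" by (cases t) auto
    have "l t < W" "r' < W" using t lt r' by auto
    have b: "i * W + l t < M" "i * W + r' < M"
      using AL_less[OF i] \<open>l t < W\<close> \<open>r' < W\<close> by simp_all
    have v: "arr s0 aAL (i * W + l t) = al (A i) (l t)" "arr s0 aAL (i * W + r') = al (A i) r'"
      "arr s0 aKK r' = kk r'" "arr s0 aHO t = ho t" "arr s0 aLC t = l t"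
      using a p lt t True r' \<open>l t < W\<close> \<open>r' < W\<close> by simp_all
    show ?thesis
    proof (cases "cut t")
      case c: True
      then have "\<not> ho t < t" "al (A i) t = 0" using True t ho_eq_iff_cut by (simp_all add: al_op)
      then show ?thesis
        using g p M tk True v upd[of 0] inv(4)
        by (simp add: ok_def body_alpha_def G_def parsed_def alphas_def)
    next
      case c: False
      then have h: "ho t < t" "al (A i) t = al (A i) (l t) * 2 ^ kk r' + al (A i) r'"
        using True t ho_eq_iff_cut by (simp_all add: al_op r')
      have am: "al (A i) (l t) * 2 ^ kk r' + al (A i) r' < M"
        using al_less_M[OF t, of "A i"] h(2) by simp
      then have "al (A i) (l t) * 2 ^ kk r' < M" by simp
      then show ?thesis
        using g p M tk True v upd[OF h(2)[symmetric]] inv(4) b h(1) am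
        by (simp add: r' ok_def body_alpha_def G_def parsed_def alphas_def)
    qed
  next
    case False
    have c: "(tk t - 2) div 4 < m" using coord_less[of t] t False by (simp add: coord_def W_def)
    have in1: "Suc (4 * m + i * m + (tk t - 2) div 4) < length xs"
      "xs ! Suc (4 * m + i * m + (tk t - 2) div 4) = of_bool (A i ((tk t - 2) div 4))"
      "Suc (4 * m + i * m + (tk t - 2) div 4) < M" "Suc (4 * m + i * m) < M" "i * m < M"
      using inp_less[OF i c] inpA[OF i c] by simp_all
    have al: "al (A i) t = (if (tk t - 2) mod 4 < 2 then of_bool (A i ((tk t - 2) div 4)) else 0)"
      using False by (simp add: al_leaf is_X_def coord_def)
    show ?thesis
      using g p M tk False inv(4) in1 al upd[of "of_bool (A i ((tk t - 2) div 4))"] upd[of 0]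
        tok_less_M[OF t]
      by (cases "(tk t - 2) mod 4 < 2")
        (simp_all add: ok_def body_alpha_def G_def parsed_def alphas_def)
  qed
qed

lemma prog_alpha_ok:
  assumes "G 0 s0" "parsed W s0"
  shows "ok xs M prog_alpha s0 (\<lambda>s'. G 0 s' \<and> parsed W s' \<and> alphas n 0 s')
    (10 + (10 + 205 * W) * n)"
proof -
  have nM: "n < M" "W < M" using small_less_M(3)[of n] small_less_M(2)[of W] by auto
  have inner: "ok xs M (For vt (Var vW) body_alpha) (set_var vi i s1)
      (\<lambda>s'. G 0 s' \<and> parsed W s' \<and> alphas (Suc i) 0 s') (5 + 205 * W)"
    if "i < n" "G 0 s1 \<and> parsed W s1 \<and> alphas i 0 s1" for i s1
    apply (rule ok_weaken)
      apply (rule ok_for[where k = W and T = 200 and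
        I = "\<lambda>t s'. G 0 s' \<and> parsed W s' \<and> alphas i t s' \<and> vars s' vi = i"])
          prefer 5
          apply (rule body_alpha_ok)
               apply (use that nM in auto)[10]
    using that by (auto simp: G_def parsed_def alphas_def less_Suc_eq nM)
  show ?thesis
    unfolding prog_alpha_def
    apply (rule ok_weaken)
      apply (rule ok_for[where k = n and
        I = "\<lambda>i s'. G 0 s' \<and> parsed W s' \<and> alphas i 0 s'"])
          prefer 5
          apply (rule inner)
           apply assumption+
    using assms nM by (auto simp: G_def alphas_def algebra_simps)
qed

section \<open>Tables of a batch\<close>

definition yw :: "nat \<Rightarrow> nat \<Rightarrow> nat" where
  "yw p c = (if odd c then xor (wd L (\<lambda>k. B (p + k) (coord c))) (mask L)
     else wd L (\<lambda>k. B (p + k) (coord c)))"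

definition ctx :: "nat \<Rightarrow> nat \<Rightarrow> st \<Rightarrow> bool" where
  "ctx r p s' \<longleftrightarrow> G r s' \<and> parsed W s' \<and> alphas n 0 s' \<and> vars s' vst = p"

abbreviation tab :: "nat \<Rightarrow> nat \<Rightarrow> nat \<Rightarrow> nat" where
  "tab p \<equiv> tb (mask L) (yw p)"

text \<open>Every row has room for \<open>D\<close> entries, but token \<open>u\<close> has
  meaningful indices only up to its own number of X-leaves, and a merge reads no others.\<close>

definition tables :: "nat \<Rightarrow> nat \<Rightarrow> st \<Rightarrow> bool" where
  "tables p t s' \<longleftrightarrow> (\<forall>u < t. \<forall>x < 2 * 2 ^ kk u. arr s' aTB (u * D + x) = tab p u x)"

definition row :: "nat \<Rightarrow> nat \<Rightarrow> nat \<Rightarrow> st \<Rightarrow> bool" where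
  "row p t x s' \<longleftrightarrow> (\<forall>y < x. arr s' aTB (t * D + y) = tab p t y)"

lemma tables_Suc:
  "tables p (Suc t) s' \<longleftrightarrow> tables p t s' \<and> row p t (2 * 2 ^ kk t) s'"
  by (auto simp: tables_def row_def less_Suc_eq)

text \<open>A frame rule: the listed registers are all that \<open>ctx\<close> depends on, so
  assignments to scratch variables preserve it.\<close>

lemma ctx_upd_var:
  "\<forall>v \<in> {0, 2, 3, 4, 5, 7, 8, 9, 10, 11, 12, 23}. f v = vars s' v \<Longrightarrow>
    ctx r p (s'\<lparr>vars := f\<rparr>) \<longleftrightarrow> ctx r p s'"
  by (auto simp: ctx_def G_def parsed_def alphas_def)

lemma ctx_upd_arr:
  "\<forall>a \<in> {0, 2, 3, 4, 7}. f a = arr s' a \<Longrightarrow> ctx r p (s'\<lparr>arr := f\<rparr>) \<longleftrightarrow> ctx r p s'"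
  by (auto simp: ctx_def G_def parsed_def alphas_def)

lemma tables_upd_var: "tables p t (s'\<lparr>vars := f\<rparr>) \<longleftrightarrow> tables p t s'"
  by (simp add: tables_def)

lemma row_upd_var: "row p t y (s'\<lparr>vars := f\<rparr>) \<longleftrightarrow> row p t y s'"
  by (simp add: row_def)

lemma tables_store:
  assumes "t < W" "x < D"
  shows "tables p t (s'\<lparr>arr := (arr s')(aTB := (arr s' aTB)(t * D + x := y))\<rparr>) \<longleftrightarrow> tables p t s'"
proof -
  have "u * D + z \<noteq> t * D + x" if "u < t" "z < 2 * 2 ^ kk u" for u z
    using TB_eq[of z x u t] kk_D[of u] that assms by auto
  then show ?thesis by (auto simp: tables_def)
qed

lemma row_store:
  assumes "t < W" "x < 2 * 2 ^ kk t" "row p t x s'" "y = tab p t x"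
  shows "row p t (Suc x) (s'\<lparr>arr := (arr s')(aTB := (arr s' aTB)(t * D + x := y))\<rparr>)"
  using assms by (auto simp: row_def less_Suc_eq)

lemma mask_less_M: "mask L < M"
  using L_le nm unfolding mask_eq_exp_minus_1 M_def by linarith

text \<open>The result is an equation between states, so that the frame rules take care of all
  invariants; \<open>a\<close> and \<open>b\<close> are leftovers in scratch variables.\<close>

lemma body_merge_ok:
  assumes t: "t < W" "tk t < 2" "\<not> cut t" and x: "x < 2 * 2 ^ kk t"
    and inv: "ctx r p s0" "tables p t s0" "row p t x s0"
    and v: "vars s0 vb = t * D" "vars s0 vl = l t" "vars s0 vz = (t - 1) * D"
      "vars s0 vc = 2 * 2 ^ kk (t - 1)" "vars s0 vtok = tk t" "vars s0 vx = x"
  shows "safe xs M body_merge s0 \<and> cost xs body_merge s0 \<le> 80 \<and>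
    (\<exists>a b. exec xs body_merge s0 = (set_var vv b (set_var vu a s0))
      \<lparr>arr := (arr s0)(aTB := (arr s0 aTB)(t * D + x := tab p t x))\<rparr>)"
proof -
  have g: "vars s0 vD = D" "vars s0 vN = mask L"
    using inv(1) by (simp_all add: ctx_def G_def)
  have lt: "l t < t" "t - 1 < t" "t - 1 < W" "l t < W" using t l_less[of t] op_pos[of t] by auto
  let ?c = "2 * 2 ^ kk (t - 1) :: nat"
  let ?x1 = "2 * (x div ?c) + x mod 2" and ?x2 = "x mod ?c"
  have kt: "kk t = kk (l t) + kk (t - 1)" using t by (simp add: kk_op)
  have "x < 2 ^ kk (l t) * ?c" using x unfolding kt power_add by (simp add: ac_simps)
  then have "x div ?c < 2 ^ kk (l t)" by (rule less_mult_imp_div_less)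
  moreover have "x mod 2 < 2" by simp
  ultimately have x1: "?x1 < 2 * 2 ^ kk (l t)" by linarith
  have x2: "?x2 < ?c" by simp
  have "kk t \<le> s" using kk_le t by simp
  then have xD: "x < D" "?x1 < D" "?x2 < D" using x x1 x2 kk_D t(1) lt
    by (meson less_le_trans)+
  have M: "t * D + x < M" "l t * D + ?x1 < M" "(t - 1) * D + ?x2 < M" "l t * D < M" "?x1 < M"
    "2 * (x div ?c) < M" "2 < M"
    using TB_less[OF t(1) xD(1)] TB_less[OF lt(4) xD(2)] TB_less[OF lt(3) xD(3)]
      small_less_M(1)[of 2] by linarith+
  have rd: "arr s0 aTB (l t * D + ?x1) = tab p (l t) ?x1"
    "arr s0 aTB ((t - 1) * D + ?x2) = tab p (t - 1) ?x2"
    using inv(2) lt x1 x2 unfolding tables_def by blast+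
  have tN: "tk t * mask L < M" using mask_less_M less_2_cases[OF t(2)] M(7) by auto
  have val: "tab p t x = or (and (tab p (l t) ?x1) (tab p (t - 1) ?x2))
      (and (tk t * mask L) (or (tab p (l t) ?x1) (tab p (t - 1) ?x2)))"
    using t by (simp add: tb_op opw_def)
  show ?thesis
    unfolding val
    using g v M tN rd by (simp add: body_merge_def) blast
qed

lemma body_word_ok:
  assumes t: "t < W" "2 \<le> tk t" and k: "k < L" and p: "p + L \<le> n"
    and v: "vars s0 vB = 4 * m + 1 + n * m" "vars s0 vst = p" "vars s0 vm = m"
      "vars s0 vtok = tk t" "vars s0 vk = k"
      "vars s0 vy = wd k (\<lambda>k. B (p + k) (coord (tk t)))"
  shows "safe xs M body_word s0 \<and> cost xs body_word s0 \<le> 40 \<and>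
    exec xs body_word s0 = set_var vy (wd (Suc k) (\<lambda>k. B (p + k) (coord (tk t)))) s0"
proof -
  have c: "coord (tk t) < m" using coord_less t by (simp add: W_def)
  have i: "p + k < n" using p k by simp
  have in1: "4 * m + 1 + n * m + (p + k) * m + coord (tk t) < length xs"
    "xs ! (4 * m + 1 + n * m + (p + k) * m + coord (tk t)) = of_bool (B (p + k) (coord (tk t)))"
    using inp_less[OF i c] inpB[OF i c] by simp_all
  have "(2::nat) ^ k \<le> 2 ^ L" using k by simp
  then have "(2::nat) ^ k < M" using L_le nm unfolding M_def by linarith
  then have M: "of_bool (B (p + k) (coord (tk t))) * (2::nat) ^ k < M"
    "4 * m + 1 + n * m + (p + k) * m + coord (tk t) < M" "4 * m + 1 + n * m + (p + k) * m < M"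
    "(p + k) * m < M" "p + k < M" "2 < M" "4 < M"
    using inp_less[OF i c] small_less_M(1)[of 4] i small_less_M(3)[of n] by auto
  show ?thesis
    using v in1 M tok_less_M[OF t(1)] t(2) unfolding coord_def
    by (simp add: body_word_def)
qed

lemma body_table_ok:
  assumes t: "t < W" and p: "p + L \<le> n" and inv: "ctx r p s0" "tables p t s0"
  shows "ok xs M body_table (set_var vt t s0)
    (\<lambda>s'. ctx r p s' \<and> tables p (Suc t) s') (200 + 85 * D + 45 * L)"
proof -
  have g: "vars s0 vD = D" "vars s0 vN = mask L" "vars s0 vL = L" "vars s0 vm = m"
      "vars s0 vB = 4 * m + 1 + n * m" "vars s0 vst = p"
    using inv(1) by (simp_all add: ctx_def G_def)
  have pa: "arr s0 aKK t = kk t" "arr s0 aHO t = ho t" "tk t < 2 \<longrightarrow> arr s0 aLC t = l t"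
    using inv(1) t unfolding ctx_def parsed_def by simp_all
  have M: "t < M" "t + 2 < M" "1 < M" "2 < M" "0 < M" "4 < M"
    using small_less_M(1)[of 4] small_less_M(2)[of t] t by simp_all
  have tD: "\<And>x. x < D \<Longrightarrow> t * D + x < M" using TB_less[OF t] .
  have tDM: "t * D < M" "Suc (t * D) < M" using tD[of 0] tD[of 1] D_ge by simp_all
  have DM: "D < M" using D_le nm unfolding M_def by linarith
  note tk = tok_W[OF t]
  define s1 where "s1 = set_var vb (t * D) (set_var vtok (tk t) (set_var vt t s0))"
  have s1: "ctx r p s1" "tables p t s1" "vars s1 vb = t * D" "vars s1 vtok = tk t"
      "vars s1 vt = t" "arr s1 = arr s0"
      "vars s1 vD = D" "vars s1 vN = mask L" "vars s1 vL = L" "vars s1 vm = m"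
      "vars s1 vB = 4 * m + 1 + n * m" "vars s1 vst = p"
    using inv g unfolding s1_def by (simp_all add: ctx_upd_var tables_upd_var)
  note upd = ctx_upd_var tables_upd_var row_upd_var ctx_upd_arr
  let ?Q = "\<lambda>s'. ctx r p s' \<and> tables p (Suc t) s'"
  \<comment> \<open>\<open>85 * D\<close> pays for a merge, at most \<open>D\<close> entries at 80 +
    5 each, and \<open>45 * L\<close> for a Y-leaf, 40 + 5 per bit; their sum serves for every kind
    of token.\<close>
  let ?T = "150 + 85 * D + 45 * L"
  have row0: "row p t 0 s'" for s' by (simp add: row_def)
  have main: "ok xs M
     (IfLess (Var vtok) (Lit 2)
      (IfLess (Ld aHO (Var vt)) (Var vt)
        (vl ::= Ld aLC (Var vt) ;; vz ::= (Var vt \<^bold>- Lit 1) \<^bold>* Var vD ;;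
         vc ::= (Lit 2 \<lless> Ld aKK (Var vt \<^bold>- Lit 1)) ;;
         For vx (Lit 2 \<lless> Ld aKK (Var vt)) body_merge)
        (St aTB (Var vb) (Lit 0) ;; St aTB (Var vb \<^bold>+ Lit 1) (Var vN)))
      (IfLess ((Var vtok \<^bold>- Lit 2) \<^bold>% Lit 4) (Lit 2)
        (For vx (Lit 4) (St aTB (Var vb \<^bold>+ Var vx)
          (Var vN \<^bold>* ((Var vx \<^bold>/ Lit 2 \<^bold>+ Var vtok) \<^bold>% Lit 2))))
        (vy ::= Lit 0 ;; For vk (Var vL) body_word ;;
         IfLess (Lit 0) (Var vtok \<^bold>% Lit 2) (vy ::= Bin BitXor (Var vy) (Var vN)) Skip ;;
         St aTB (Var vb) (Var vy) ;; St aTB (Var vb \<^bold>+ Lit 1) (Var vy)))) s1 ?Q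
     (30 + ?T)" (is "ok _ _ (IfLess _ _ (IfLess _ _ ?merge ?cut) (IfLess _ _ ?x ?y)) _ _ _")
  proof -
    have merge: "ok xs M ?merge s1 ?Q ?T" if op: "tk t < 2" "\<not> cut t"
    proof -
      have lt: "l t < t" "t - 1 < t" "t - 1 < W" "l t < W" "Suc 0 \<le> t"
        using t op l_less[of t] op_pos[of t] by auto
      have k1: "arr s0 aKK (t - Suc 0) = kk (t - Suc 0)"
        using inv(1) lt unfolding ctx_def parsed_def by simp
      have "2 * 2 ^ kk (t - 1) < M" "2 * 2 ^ kk t < M" "(t - 1) * D < M"
        using kk_D[OF lt(3)] kk_D[OF t] DM TB_less[OF lt(3), of 0] D_ge by auto
      note b = this
      define s2 where "s2 = set_var vc (2 * 2 ^ kk (t - 1)) (set_var vz ((t - 1) * D)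
        (set_var vl (l t) s1))"
      have s2: "ctx r p s2" "tables p t s2"
        "vars s2 vb = t * D" "vars s2 vl = l t" "vars s2 vz = (t - 1) * D"
        "vars s2 vc = 2 * 2 ^ kk (t - 1)" "vars s2 vtok = tk t" "vars s2 vt = t" "arr s2 = arr s0"
        using s1 unfolding s2_def by (simp_all add: upd)
      let ?I = "\<lambda>x s'. ctx r p s' \<and> tables p t s' \<and> row p t x s' \<and>
        vars s' vb = t * D \<and> vars s' vl = l t \<and> vars s' vz = (t - 1) * D \<and>
        vars s' vc = 2 * 2 ^ kk (t - 1) \<and> vars s' vtok = tk t"
      have loop: "ok xs M (For vx (Lit 2 \<lless> Ld aKK (Var vt)) body_merge) s2
          (?I (2 * 2 ^ kk t)) (sizeE (Lit 2 \<lless> Ld aKK (Var vt)) + 3 + 2 * 2 ^ kk t * (80 + 5))"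
      proof (rule ok_for[where I = ?I])
        fix x s3 assume x: "x < 2 * 2 ^ kk t" and I: "?I x s3"
        then have xD: "x < D" using kk_D[OF t] by simp
        from I obtain a b where m: "safe xs M body_merge (set_var vx x s3)"
          "cost xs body_merge (set_var vx x s3) \<le> 80"
          "exec xs body_merge (set_var vx x s3) =
            (set_var vv b (set_var vu a (set_var vx x s3)))
            \<lparr>arr := (arr s3)(aTB := (arr s3 aTB)(t * D + x := tab p t x))\<rparr>"
          using body_merge_ok[OF t op x, of r p "set_var vx x s3"] by (auto simp: upd)
        define s4 where "s4 = set_var vv b (set_var vu a (set_var vx x s3))"
        have s4: "?I x s4" "arr s4 = arr s3" using I unfolding s4_def by (simp_all add: upd)
        have "?I (Suc x) (exec xs body_merge (set_var vx x s3))"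
          unfolding m(3) s4_def[symmetric] s4(2)[symmetric]
          using s4(1) tables_store[OF t xD] row_store[OF t x, of p s4]
          by (simp add: upd)
        then show "ok xs M body_merge (set_var vx x s3) (?I (Suc x)) 80"
          using m by (simp add: ok_def)
      qed (use s2 b pa row0 M t in auto)
      have "2 * 2 ^ kk t * 85 \<le> 85 * D" using kk_D[OF t] by simp
      then show ?thesis
        using loop s1 pa op k1 b lt M t unfolding s2_def
        by (simp add: ok_def tables_Suc) 
    qed
    have cut: "ok xs M ?cut s1 ?Q ?T" if op: "tk t < 2" "cut t"
    proof -
      have k0: "kk t = 0" using op t by (simp add: kk_op)
      have tab: "tab p t 0 = 0" "tab p t (Suc 0) = mask L" using op t by (simp_all add: tb_op)
      define s2 where "s2 = s1\<lparr>arr := (arr s1)(aTB := (arr s1 aTB)(t * D + 0 := 0))\<rparr>"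
      define s3 where "s3 = s2\<lparr>arr := (arr s2)(aTB := (arr s2 aTB)(t * D + Suc 0 := mask L))\<rparr>"
      have s2: "ctx r p s2" "tables p t s2" "row p t (Suc 0) s2"
        using s1 tables_store[OF t, of 0 p s1] row_store[OF t, of 0 p s1] row0 D_ge tab k0
        unfolding s2_def by (simp_all add: upd)
      have s3: "ctx r p s3" "tables p (Suc t) s3"
        using s2 tables_store[OF t, of "Suc 0" p s2] row_store[OF t, of "Suc 0" p s2] D_ge tab k0
        unfolding s3_def tables_Suc by (simp_all add: upd numeral_2_eq_2)
      have "exec xs ?cut s1 = s3" unfolding s3_def s2_def using s1 by simp
      then show ?thesis using s3 s1 M tDM by (simp add: ok_def)
    qed
    have X: "ok xs M ?x s1 ?Q ?T" if lf: "2 \<le> tk t" "is_X (tk t)"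
    proof -
      \<comment> \<open>One bit for the leaf and one for the hole make the four rounds of
        \<open>Lit 4\<close>.\<close>
      have k1: "kk t = 1" using lf by (simp add: kk_leaf)
      have tkM: "tk t + 2 < M"
      proof -
        have "coord (tk t) < m" using coord_less t lf by (simp add: W_def)
        then have "tk t < 4 * m + 2" unfolding coord_def by linarith
        then show ?thesis using nm unfolding M_def by linarith
      qed
      let ?I = "\<lambda>x s'. ctx r p s' \<and> tables p t s' \<and> row p t x s' \<and>
        vars s' vb = t * D \<and> vars s' vtok = tk t"
      let ?b = "St aTB (Var vb \<^bold>+ Var vx) (Var vN \<^bold>* ((Var vx \<^bold>/ Lit 2 \<^bold>+ Var vtok) \<^bold>% Lit 2))"
      have loop: "ok xs M ?x s1 (?I 4) (sizeE (Lit 4) + 3 + 4 * (25 + 5))"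
      proof (rule ok_for[where I = ?I])
        fix x s3 assume x: "x < 4" and I: "?I x s3"
        then have xD: "x < D" and x2: "x < 2 * 2 ^ kk t" using k1 D_ge by simp_all
        have N: "vars s3 vN = mask L" using I by (simp add: ctx_def G_def)
        define s4 where "s4 = set_var vx x s3"
        have s4: "?I x s4" "arr s4 = arr s3" using I unfolding s4_def by (simp_all add: upd)
        have tx: "tab p t x = mask L * ((x div 2 + tk t) mod 2)" using lf by (simp add: tb_leaf)
        have "mask L * ((x div 2 + tk t) mod 2) < M"
          using mask_less_M M by (cases "even (x div 2 + tk t)") (auto simp: mod2_eq_if)
        moreover have "x div 2 + tk t < M" using x tkM by linarith
        ultimately have "safe xs M ?b s4 \<and> cost xs ?b s4 \<le> 25"
          using tD[OF xD] M I N by (simp add: s4_def)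
        moreover have "?I (Suc x) (exec xs ?b s4)"
          using s4 tables_store[OF t xD, of p s4] row_store[OF t x2, of p s4] tx N
          by (simp add: upd) (simp add: s4_def upd)
        ultimately show "ok xs M ?b (set_var vx x s3) (?I (Suc x)) 25"
          unfolding s4_def ok_def by blast
      qed (use s1 row0 M in auto)
      show ?thesis
        by (rule ok_weaken[OF loop]) (auto simp: tables_Suc k1)
    qed
    have Y: "ok xs M ?y s1 ?Q ?T" if lf: "2 \<le> tk t" "\<not> is_X (tk t)"
    proof -
      have k0: "kk t = 0" using lf by (simp add: kk_leaf)
      let ?w = "\<lambda>k. wd k (\<lambda>k. B (p + k) (coord (tk t)))"
      let ?I = "\<lambda>k s'. ctx r p s' \<and> tables p t s' \<and> vars s' vy = ?w k \<and>
        vars s' vb = t * D \<and> vars s' vtok = tk t"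
      have loop: "ok xs M (For vk (Var vL) body_word) s2 (?I L)
          (sizeE (Var vL) + 3 + L * (40 + 5))" if "?I 0 s2" for s2
      proof (rule ok_for[where I = ?I])
        fix k s3 assume k: "k < L" and I: "?I k s3"
        have v: "vars s3 vB = 4 * m + 1 + n * m" "vars s3 vm = m" "vars s3 vst = p"
          using I by (simp_all add: ctx_def G_def)
        show "ok xs M body_word (set_var vk k s3) (?I (Suc k)) 40"
          using body_word_ok[OF t lf(1) k p, of "set_var vk k s3"] v I
          by (simp add: ok_def upd)
      qed (use that L_less_n small_less_M(3)[of n] in \<open>auto simp: ctx_def G_def\<close>)
      have rest: "ok xs M (IfLess (Lit 0) (Var vtok \<^bold>% Lit 2) (vy ::= Bin BitXor (Var vy) (Var vN)) Skip ;;
         St aTB (Var vb) (Var vy) ;; St aTB (Var vb \<^bold>+ Lit 1) (Var vy)) s2 ?Q 60"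
        if I: "?I L s2" for s2
      proof -
        have N: "vars s2 vN = mask L" using I by (simp add: ctx_def G_def)
        define s3 where "s3 = (if odd (tk t) then set_var vy (yw p (tk t)) s2 else s2)"
        have s3: "ctx r p s3" "tables p t s3" "vars s3 vy = yw p (tk t)" "vars s3 vb = t * D"
          using I unfolding s3_def by (simp_all add: upd yw_def)
        have tab: "tab p t x = yw p (tk t)" for x using lf by (simp add: tb_leaf)
        define s4 where "s4 = s3\<lparr>arr := (arr s3)(aTB := (arr s3 aTB)(t * D + 0 := yw p (tk t)))\<rparr>"
        define s5 where "s5 = s4\<lparr>arr := (arr s4)(aTB := (arr s4 aTB)(t * D + Suc 0 := yw p (tk t)))\<rparr>"
        have s4: "ctx r p s4" "tables p t s4" "row p t (Suc 0) s4"
          using s3 tables_store[OF t, of 0 p s3] row_store[OF t, of 0 p s3] row0 D_ge tab k0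
          unfolding s4_def by (simp_all add: upd)
        have s5: "ctx r p s5" "tables p (Suc t) s5"
          using s4 tables_store[OF t, of "Suc 0" p s4] row_store[OF t, of "Suc 0" p s4] D_ge tab k0
          unfolding s5_def tables_Suc by (simp_all add: upd numeral_2_eq_2)
        have e: "exec xs (IfLess (Lit 0) (Var vtok \<^bold>% Lit 2) (vy ::= Bin BitXor (Var vy) (Var vN)) Skip) s2 = s3"
          using I N unfolding s3_def by (auto simp: yw_def mod2_eq_if)
        have "exec xs (St aTB (Var vb) (Var vy) ;; St aTB (Var vb \<^bold>+ Lit 1) (Var vy)) s3 = s5"
          unfolding s5_def s4_def using s3 by simp
        then show ?thesis using e s5 s3 M tDM unfolding ok_def by simp
      qed
      have "ok xs M ?y s1 ?Q (sizeE (Lit 0) + 1 + (sizeE (Var vL) + 3 + L * (40 + 5) + 60))"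
        apply (rule ok_asg[rotated])
         apply (rule ok_seq[OF loop rest])
        using s1 M by (simp_all add: upd)
      then show ?thesis by (rule ok_weaken) simp_all
    qed
    have op: "ok xs M (IfLess (Ld aHO (Var vt)) (Var vt) ?merge ?cut) s1 ?Q
      (sizeE (Ld aHO (Var vt)) + sizeE (Var vt) + 2 + ?T)" if "tk t < 2"
      apply (rule ok_if)
      using merge[OF that] cut[OF that] ho_eq_iff_cut[OF t that] s1 pa M by auto
    have leaf: "ok xs M (IfLess ((Var vtok \<^bold>- Lit 2) \<^bold>% Lit 4) (Lit 2) ?x ?y) s1 ?Q
      (sizeE ((Var vtok \<^bold>- Lit 2) \<^bold>% Lit 4) + sizeE (Lit 2) + 2 + ?T)" if "2 \<le> tk t"
      apply (rule ok_if)
      using X[OF that] Y[OF that] s1 M tok_less_M[OF t] that by (auto simp: is_X_def)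
    show ?thesis
      apply (rule ok_weaken)
        apply (rule ok_if[where T = "?T + 20"])
           prefer 3
           apply (rule ok_weaken[OF op])
             prefer 6
             apply (rule ok_weaken[OF leaf])
      using s1 M by auto
  qed
  have pre: "ok xs M (vtok ::= Inp (Var vt \<^bold>+ Lit 2) ;; vb ::= Var vt \<^bold>* Var vD ;; C)
      (set_var vt t s0) Q (20 + T)" if "ok xs M C s1 Q T" for C Q T
    using that tk M g tDM by (simp add: ok_def s1_def)
  show ?thesis
    unfolding body_table_def by (rule ok_weaken[OF pre[OF main]]) simp_all
qed

lemma prog_table_ok:
  assumes p: "p + L \<le> n" and inv: "ctx r p s0"
  shows "ok xs M prog_table s0 (\<lambda>s'. ctx r p s' \<and> tables p W s')
    (10 + W * (205 + 85 * D + 45 * L))"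
  unfolding prog_table_def
  apply (rule ok_weaken)
    apply (rule ok_for[where k = W and I = "\<lambda>t s'. ctx r p s' \<and> tables p t s'"])
        prefer 5
        apply (rule body_table_ok[OF _ p])
          apply assumption
         apply (erule conjunct1)
        apply (erule conjunct2)
  using inv small_less_M(2)[of W] by (auto simp: tables_def ctx_def G_def algebra_simps)

section \<open>Evaluating one vector of A against a batch\<close>

definition lv :: "nat \<Rightarrow> nat \<Rightarrow> nat \<Rightarrow> bool" where
  "lv i j c = ((if is_X c then A i (coord c) else B j (coord c)) \<noteq> odd c)"

definition root :: "nat \<Rightarrow> nat \<Rightarrow> bool" where
  "root i j = val tk (lv i j) (W - 1)"

abbreviation pc_word :: "nat \<Rightarrow> nat \<Rightarrow> (nat \<Rightarrow> nat) \<Rightarrow> nat \<Rightarrow> nat" where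
  "pc_word p i \<equiv> piece (mask L) (yw p) (A i)"

lemma bit_pc_word:
  assumes "k < L" "t < W" "0 < ho t \<Longrightarrow> bit (sl (ho t)) k = val tk (lv i (p + k)) (ho t)"
  shows "bit (pc_word p i sl t) k = val tk (lv i (p + k)) t"
  by (rule bit_piece[where L = L])
    (use assms in \<open>auto simp: lv_def yw_def bit_wd bit_xor_iff bit_mask_iff\<close>)

lemma evs_before:
  assumes "e < length (evs W)" "u \<in> set (evs W)" "u < evs W ! e"
  shows "\<exists>e' < e. evs W ! e' = u"
proof -
  obtain e' where e': "e' < length (evs W)" "evs W ! e' = u"
    using assms(2) by (auto simp: in_set_conv_nth)
  have "e' < e"
  proof (rule ccontr)
    assume "\<not> e' < e"
    then consider "e = e'" | "e < e'" by linarith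
    then show False
      using sorted_wrt_nth_less[OF evs_sorted, of e e' W] e' assms(3) by cases auto
  qed
  then show ?thesis using e' by blast
qed

text \<open>Only the first \<open>e\<close> cut tokens are covered, since the other slots may still
  hold values for another vector or batch.\<close>

definition slots :: "nat \<Rightarrow> nat \<Rightarrow> nat \<Rightarrow> st \<Rightarrow> bool" where
  "slots p i e s' \<longleftrightarrow> (\<forall>e' < e. \<forall>k < L.
     bit (arr s' aSL (evs W ! e')) k = val tk (lv i (p + k)) (evs W ! e'))"

text \<open>A hole is a cut token not after \<open>t\<close>, and \<open>evs\<close> is sorted, so
  it precedes event \<open>e\<close> whenever \<open>t\<close> does. The alternative
  \<open>e = length (evs W)\<close> is for the piece at the root, evaluated after all
  events.\<close>

lemma slots_ho:
  assumes "slots p i e s'" "k < L" "t < W" "0 < ho t"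
    and "e = length (evs W) \<or> e < length (evs W) \<and> t < evs W ! e"
  shows "bit (arr s' aSL (ho t)) k = val tk (lv i (p + k)) (ho t)"
proof -
  have "ho t \<in> set (evs (Suc t))" by (rule ho_event) fact+
  then have "ho t \<in> set (evs W)" "ho t \<le> t" using assms(3) by (auto simp: set_evs)
  then have "\<exists>e' < e. evs W ! e' = ho t"
    using assms(5) evs_before[of e "ho t"] by (auto simp: in_set_conv_nth)
  then show ?thesis using assms(1,2) unfolding slots_def by metis
qed

lemma slots_upd_var: "slots p i e (s'\<lparr>vars := f\<rparr>) \<longleftrightarrow> slots p i e s'"
  by (simp add: slots_def)

lemmas upd = ctx_upd_var ctx_upd_arr tables_upd_var slots_upd_var

lemma tables_upd_arr: "f 8 = arr s' 8 \<Longrightarrow> tables p t (s'\<lparr>arr := f\<rparr>) \<longleftrightarrow> tables p t s'"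
  by (simp add: tables_def)

lemma prog_piece_ok:
  assumes t: "t < W" and i: "i < n" and inv: "ctx r p s0" "tables p W s0"
    and v: "vars s0 vi = i" "vars s0 v = t" "v \<noteq> vb"
  shows "safe xs M (prog_piece u v) s0 \<and> cost xs (prog_piece u v) s0 \<le> 80 \<and>
    (\<exists>b. exec xs (prog_piece u v) s0 =
      set_var u (pc_word p i (arr s0 aSL) t) (set_var vb b s0))"
proof -
  have g: "vars s0 vD = D" "vars s0 vW = W" using inv(1) by (simp_all add: ctx_def G_def)
  have a: "arr s0 aAL (i * W + t) = al (A i) t" "arr s0 aHO t = ho t"
    using inv(1) t i by (simp_all add: ctx_def alphas_def parsed_def)
  have al: "2 * al (A i) t + 1 < 2 * 2 ^ kk t" using al_less[OF t, of "A i"] by linarith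
  then have "2 * al (A i) t + 1 < D" using kk_D[OF t] by linarith
  note M1 = TB_less[OF t this]
  have M: "i * W + t < M" "i * W < M" "t * D < M" "2 * al (A i) t < M" "t < M" "2 < M" "1 < M"
    "t * D + 2 * al (A i) t < M" "t * D + 2 * al (A i) t + 1 < M"
    using M1 AL_less[OF i t] small_less_M(1)[of 2] small_less_M(2)[of t] t by linarith+
  have "ho t \<le> t" using ho_le[OF t] .
  then have hM: "ho t < M" using M by linarith
  have rd: "arr s0 aTB (t * D + x) = tab p t x" if "x < 2 * 2 ^ kk t" for x
    using inv(2) t that unfolding tables_def by blast
  have tb: "arr s0 aTB (t * D + 2 * al (A i) t) = tab p t (2 * al (A i) t)"
    "arr s0 aTB (t * D + 2 * al (A i) t + 1) = tab p t (2 * al (A i) t + 1)"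
    using rd[of "2 * al (A i) t"] rd[of "2 * al (A i) t + 1"] al by simp_all
  show ?thesis
    unfolding prog_piece_def piece_def
    using g a v M hM tb by auto
qed

lemma body_event_ok:
  assumes e: "e < length (evs W)" and i: "i < n"
    and inv: "ctx r p s0" "tables p W s0" "slots p i e s0" "vars s0 vi = i"
  shows "ok xs M body_event (set_var ve e s0)
    (\<lambda>s'. ctx r p s' \<and> tables p W s' \<and> slots p i (Suc e) s' \<and> vars s' vi = i) 300"
proof -
  define t where "t = evs W ! e"
  have "t \<in> set (evs W)" using e by (simp add: t_def)
  then have t: "t < W" "tk t < 2" "cut t" by (simp_all add: set_evs)
  have lt: "l t < t" "t - 1 < t" "l t < W" "t - 1 < W" "Suc 0 \<le> t"
    using t l_less[of t] op_pos[of t] by auto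
  have g: "vars s0 vN = mask L" using inv(1) by (simp add: ctx_def G_def)
  have a: "arr s0 aEV e = t" "arr s0 aLC t = l t"
    using inv(1) e t by (simp_all add: ctx_def parsed_def t_def)
  have "e < W" using e length_evs_le[of W] by simp
  then have M: "e < M" "t < M" "t + 2 < M" "2 < M" "1 < M" "l t < M"
    using small_less_M(1)[of 2] small_less_M(2)[of t] small_less_M(2)[of e] t lt by simp_all
  have tN: "tk t * mask L < M" using mask_less_M less_2_cases[OF t(2)] M by auto
  define s1 where "s1 = set_var vz (t - 1) (set_var vl (l t) (set_var vtok (tk t) (set_var vt t
     (set_var ve e s0))))"
  have s1: "ctx r p s1" "tables p W s1" "vars s1 vi = i" "vars s1 vl = l t" "arr s1 = arr s0"
    using inv unfolding s1_def by (simp_all add: upd)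
  obtain b2 where 2: "safe xs M (prog_piece vu vl) s1" "cost xs (prog_piece vu vl) s1 \<le> 80"
    "exec xs (prog_piece vu vl) s1 = set_var vu (pc_word p i (arr s0 aSL) (l t)) (set_var vb b2 s1)"
    using prog_piece_ok[OF lt(3) i s1(1-4), of vu] s1(5) by auto
  define s2 where "s2 = set_var vu (pc_word p i (arr s0 aSL) (l t)) (set_var vb b2 s1)"
  have s2: "ctx r p s2" "tables p W s2" "vars s2 vi = i" "vars s2 vz = t - 1" "arr s2 = arr s0"
    using s1 unfolding s2_def by (simp_all add: upd) (simp add: s1_def)
  obtain b3 where 3: "safe xs M (prog_piece vv vz) s2" "cost xs (prog_piece vv vz) s2 \<le> 80"
    "exec xs (prog_piece vv vz) s2 = set_var vv (pc_word p i (arr s0 aSL) (t - 1)) (set_var vb b3 s2)"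
    using prog_piece_ok[OF lt(4) i s2(1-4), of vv] s2(5) by auto
  define s3 where "s3 = set_var vv (pc_word p i (arr s0 aSL) (t - 1)) (set_var vb b3 s2)"
  have s3: "ctx r p s3" "tables p W s3" "vars s3 vi = i" "arr s3 = arr s0"
    using s2 unfolding s3_def by (simp_all add: upd)
  have v3: "vars s3 vu = pc_word p i (arr s0 aSL) (l t)"
    "vars s3 vv = pc_word p i (arr s0 aSL) (t - 1)"
    "vars s3 vtok = tk t" "vars s3 vN = mask L" "vars s3 vt = t"
    using g unfolding s3_def s2_def s1_def by simp_all
  let ?w = "opw (mask L) (tk t) (pc_word p i (arr s0 aSL) (l t)) (pc_word p i (arr s0 aSL) (t - 1))"
  define s4 where "s4 = s3\<lparr>arr := (arr s3)(aSL := (arr s3 aSL)(t := ?w))\<rparr>"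
  have s4: "ctx r p s4" "tables p W s4" "vars s4 vi = i"
    using s3 unfolding s4_def by (simp_all add: upd tables_upd_arr)
  have w: "bit ?w k = val tk (lv i (p + k)) t" if k: "k < L" for k
  proof -
    have "bit (pc_word p i (arr s0 aSL) u) k = val tk (lv i (p + k)) u" if "u < t" for u
      using bit_pc_word[OF k, of u] slots_ho[OF inv(3) k, of u] that t e unfolding t_def by auto
    then show ?thesis
      unfolding bit_opw[OF k t(2)] using t(2) lt by (simp add: val.simps[of _ _ t])
  qed
  have ne: "evs W ! e' \<noteq> t" if "e' < e" for e'
    using sorted_wrt_nth_less[OF evs_sorted that] e unfolding t_def by fastforce
  have "slots p i (Suc e) s4"
    using inv(3) w ne s3(4) unfolding slots_def s4_def t_def by (auto simp: less_Suc_eq)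
  then have Q: "ctx r p s4 \<and> tables p W s4 \<and> slots p i (Suc e) s4 \<and> vars s4 vi = i"
    using s4 by simp
  have last: "safe xs M C s3 \<and> exec xs C s3 = s4 \<and> cost xs C s3 \<le> 40"
    if "C = St aSL (Var vt) ((Var vu \<^bold>& Var vv) \<^bold>| ((Var vtok \<^bold>* Var vN) \<^bold>& (Var vu \<^bold>| Var vv)))" for C
    using v3 M tN unfolding that by (simp add: s4_def opw_def)
  have mid: "ok xs M (prog_piece vu vl ;; prog_piece vv vz ;; C) s1 Q 200"
    if "safe xs M C s3 \<and> exec xs C s3 = s4 \<and> cost xs C s3 \<le> 40" "Q s4" for C Q
    using 2 3 that unfolding s2_def[symmetric] s3_def[symmetric] by (simp add: ok_def)
  have pre: "ok xs M (vt ::= Ld aEV (Var ve) ;; vtok ::= Inp (Var vt \<^bold>+ Lit 2) ;;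
      vl ::= Ld aLC (Var vt) ;; vz ::= Var vt \<^bold>- Lit 1 ;; C) (set_var ve e s0) Q (40 + T)"
    if "ok xs M C s1 Q T" for C Q T
    using that a M tok_W[OF t(1)] lt by (simp add: ok_def s1_def)
  let ?Q = "\<lambda>s'. ctx r p s' \<and> tables p W s' \<and> slots p i (Suc e) s' \<and> vars s' vi = i"
  show ?thesis
    unfolding body_event_def
    by (rule ok_weaken[OF pre[OF mid[where Q = ?Q, OF last[OF refl] Q]]]) simp_all
qed

lemma ctx_set_res: "ctx r p s' \<Longrightarrow> ctx x p (set_var vres x s')"
  by (auto simp: ctx_def G_def parsed_def alphas_def)

lemma body_query_ok:
  assumes i: "i < n" and inv: "ctx (of_bool R) p s0" "tables p W s0"
  shows "ok xs M body_query (set_var vi i s0)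
    (\<lambda>s'. ctx (of_bool (R \<or> (\<exists>k < L. root i (p + k)))) p s' \<and> tables p W s')
    (200 + 305 * length (evs W))"
proof -
  let ?E = "length (evs W)"
  let ?r = "of_bool R :: nat"
  let ?I = "\<lambda>e s'. ctx ?r p s' \<and> tables p W s' \<and> slots p i e s' \<and> vars s' vi = i"
  have loop: "ok xs M (For ve (Var vE) body_event) (set_var vi i s0) (?I ?E)
      (sizeE (Var vE) + 3 + ?E * (300 + 5))"
  proof (rule ok_for[where I = ?I])
    show "ok xs M body_event (set_var ve e s1) (?I (Suc e)) 300" if "e < ?E" "?I e s1" for e s1
      by (rule body_event_ok) (use that i in auto)
    show "?I 0 (set_var vi i s0)" using inv by (simp add: upd) (simp add: slots_def)
    show "eval xs (Var vE) (set_var vi i s0) = ?E" using inv by (simp add: ctx_def parsed_def)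
    show "?E < M" using length_evs_le[of W] small_less_M(2)[of W] by simp
  qed simp
  have rest: "ok xs M (vz ::= Var vW \<^bold>- Lit 1 ;; prog_piece vu vz ;;
      IfLess (Lit 0) (Var vu \<^bold>& Var vN) (vres ::= Lit 1) Skip) s1
    (\<lambda>s'. ctx (of_bool (R \<or> (\<exists>k < L. root i (p + k)))) p s' \<and> tables p W s') 150"
    if I: "?I ?E s1" for s1
  proof -
    have g: "vars s1 vW = W" "vars s1 vN = mask L" "vars s1 vi = i"
      using I by (simp_all add: ctx_def G_def)
    define s2 where "s2 = set_var vz (W - 1) s1"
    have s2: "ctx ?r p s2" "tables p W s2" "vars s2 vi = i" "vars s2 vz = W - 1" "arr s2 = arr s1"
      "vars s2 vN = mask L"
      using I g unfolding s2_def by (simp_all add: upd)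
    have W1: "W - 1 < W" using W_bounds by simp
    let ?w = "pc_word p i (arr s1 aSL) (W - 1)"
    obtain b where 2: "safe xs M (prog_piece vu vz) s2" "cost xs (prog_piece vu vz) s2 \<le> 80"
      "exec xs (prog_piece vu vz) s2 = set_var vu ?w (set_var vb b s2)"
      using prog_piece_ok[OF W1 i s2(1-4), of vu] s2(5) by auto
    define s3 where "s3 = set_var vu ?w (set_var vb b s2)"
    have s3: "ctx ?r p s3" "tables p W s3" "vars s3 vu = ?w" "vars s3 vN = mask L"
      using s2 unfolding s3_def by (simp_all add: upd)
    have "bit ?w k = root i (p + k)" if "k < L" for k
      unfolding root_def
      by (rule bit_pc_word[OF that W1], rule slots_ho[OF _ that W1]) (use I in auto)
    \<comment> \<open>The invariants describe bits below \<open>L\<close> only; the mask restricts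
      the test to these.\<close>
    then have nz: "and ?w (mask L) \<noteq> 0 \<longleftrightarrow> (\<exists>k < L. root i (p + k))"
      by (auto simp: bit_eq_iff bit_and_iff bit_mask_iff)
    define s4 where "s4 = (if and ?w (mask L) \<noteq> 0 then set_var vres 1 s3 else s3)"
    have s4: "ctx (of_bool (R \<or> (\<exists>k < L. root i (p + k)))) p s4" "tables p W s4"
      using s3 ctx_set_res[OF s3(1), of 1] unfolding s4_def nz by (auto simp: upd)
    have M: "0 < M" "1 < M" using small_less_M(1)[of 1] by simp_all
    have last: "safe xs M C s3 \<and> exec xs C s3 = s4 \<and> cost xs C s3 \<le> 20"
      if "C = IfLess (Lit 0) (Var vu \<^bold>& Var vN) (vres ::= Lit 1) Skip" for C
      using s3 M unfolding that by (simp add: s4_def)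
    have pre: "ok xs M (vz ::= Var vW \<^bold>- Lit 1 ;; prog_piece vu vz ;; C) s1 Q 150"
      if "safe xs M C s3 \<and> exec xs C s3 = s4 \<and> cost xs C s3 \<le> 20" "Q s4" for C Q
    proof -
      have "exec xs (vz ::= Var vW \<^bold>- Lit 1) s1 = s2" using g by (simp add: s2_def)
      moreover have "safe xs M (vz ::= Var vW \<^bold>- Lit 1) s1"
        using g M W_bounds small_less_M(2)[of W] by simp
      ultimately show ?thesis
        using 2 that unfolding s3_def[symmetric] ok_def safe.simps(4) exec.simps(4) cost.simps(4)
        by simp
    qed
    show ?thesis by (rule pre[OF last[OF refl]]) (use s4 in blast)
  qed
  show ?thesis
    unfolding body_query_def
    by (rule ok_weaken[OF ok_seq[OF loop rest]]) simp_all
qed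

section \<open>Running through the batches\<close>

definition start :: "nat \<Rightarrow> nat" where
  "start j = min (j * L) (n - L)"

lemma start_le: "start j + L \<le> n"
  using L_less_n by (auto simp: start_def)

definition batch_time :: nat where
  "batch_time = 100 + W * (205 + 85 * D + 45 * L) + n * (205 + 305 * length (evs W))"

definition found :: "nat \<Rightarrow> bool" where
  "found j \<longleftrightarrow> (\<exists>j' < j. \<exists>i < n. \<exists>k < L. root i (start j' + k))"

lemma body_batch_ok:
  assumes j: "j < n div L + 1"
    and inv: "G (of_bool (found j)) s0" "parsed W s0" "alphas n 0 s0"
  shows "ok xs M body_batch (set_var vj j s0)
    (\<lambda>s'. G (of_bool (found (Suc j))) s' \<and> parsed W s' \<and> alphas n 0 s') batch_time"
proof -
  let ?r = "of_bool (found j) :: nat"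
  let ?p = "start j"
  define s1 where "s1 = set_var vst ?p (set_var vj j s0)"
  have g: "vars s0 vL = L" "vars s0 vn = n" using inv(1) by (simp_all add: G_def)
  have s1: "ctx ?r ?p s1"
    using inv unfolding s1_def by (auto simp: ctx_def G_def parsed_def alphas_def)
  have "j * L \<le> n div L * L" using j by (intro mult_le_mono1) simp
  also have "\<dots> \<le> n" by simp
  finally have "j * L \<le> n" .
  then have M: "j * L < M" "n - L < M" "L \<le> n" using small_less_M(3)[of n] L_less_n by simp_all
  let ?I = "\<lambda>i s'. ctx (of_bool (found j \<or> (\<exists>i' < i. \<exists>k < L. root i' (?p + k)))) ?p s' \<and> tables ?p W s'"
  have hot: "ok xs M (For vi (Var vn) body_query) s2 (?I n)
      (sizeE (Var vn) + 3 + n * (200 + 305 * length (evs W) + 5))"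
    if "ctx ?r ?p s2 \<and> tables ?p W s2" for s2
  proof (rule ok_for[where I = ?I])
    fix i s3 assume "i < n" "?I i s3"
    then show "ok xs M body_query (set_var vi i s3) (?I (Suc i)) (200 + 305 * length (evs W))"
      using ok_weaken[OF body_query_ok[OF \<open>i < n\<close>, of
        "found j \<or> (\<exists>i' < i. \<exists>k < L. root i' (?p + k))" ?p s3]] 
      by (simp add: less_Suc_eq ex_disj_distrib conj_disj_distribR disj_assoc)
  qed (use that small_less_M(3)[of n] in \<open>auto simp: ctx_def G_def\<close>)
  have "found (Suc j) \<longleftrightarrow> found j \<or> (\<exists>i' < n. \<exists>k < L. root i' (?p + k))"
    by (auto simp: found_def less_Suc_eq)
  note Q = this
  have pre: "ok xs M (vst ::= Var vj \<^bold>* Var vL ;;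
      IfLess (Var vn \<^bold>- Var vL) (Var vst) (vst ::= Var vn \<^bold>- Var vL) Skip ;; C) (set_var vj j s0) Q (40 + T)"
    if "ok xs M C s1 Q T" for C Q T
  proof (cases "n - L < j * L")
    case True
    then have "start j = n - L" by (simp add: start_def)
    then show ?thesis using that True g M by (simp add: ok_def s1_def)
  next
    case False
    then have "start j = j * L" by (simp add: start_def)
    then show ?thesis using that False g M by (simp add: ok_def s1_def)
  qed
  show ?thesis
    unfolding body_batch_def
    apply (rule ok_weaken[OF pre[OF ok_seq[OF prog_table_ok[OF start_le s1] hot]]])
      apply assumption
     apply (simp add: ctx_def Q)
    apply (simp add: batch_time_def algebra_simps)
    done
qed

text \<open>The answer is a disjunction over all pairs, so checking a vector in two overlapping
  batches does no harm, and it remains to see that every vector is in some batch.\<close>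

lemma found_all: "found (n div L + 1) \<longleftrightarrow> (\<exists>i < n. \<exists>j < n. root i j)"
proof
  assume "found (n div L + 1)"
  then obtain j i k where "i < n" "k < L" "root i (start j + k)" by (auto simp: found_def)
  moreover from this have "start j + k < n" using start_le[of j] by simp
  ultimately show "\<exists>i < n. \<exists>j < n. root i j" by blast
next
  assume "\<exists>i < n. \<exists>j < n. root i j"
  then obtain i j where ij: "i < n" "j < n" "root i j" by blast
  \<comment> \<open>Vector \<open>j\<close> is in batch \<open>j div L\<close>: moving the start
    back to \<open>n - L\<close> keeps it at or before \<open>j\<close>, and the batch then extends
    to the last vector.\<close>
  have "start (j div L) \<le> j" by (simp add: start_def min.coboundedI1)
  moreover have "j < j div L * L + L"
    using mod_less_divisor[OF L_pos, of j] div_mult_mod_eq[of j L] by linarith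
  then have "j < start (j div L) + L" using ij(2) L_less_n by (simp add: start_def min_def)
  moreover have "j div L < n div L + 1" using ij(2) div_le_mono[of j n L] by simp
  ultimately show "found (n div L + 1)"
    unfolding found_def using ij
    by (intro exI[of _ "j div L"] conjI exI[of _ i] exI[of _ "j - start (j div L)"]) auto
qed

theorem prog_ok:
  "ok xs M prog \<lparr>vars = \<lambda>_. 0, arr = \<lambda>_ _. 0\<rparr>
     (\<lambda>s'. vars s' 0 = (if \<exists>i < n. \<exists>j < n. root i j then 1 else 0))
     (100 + 30 * n + 205 * W + (10 + 205 * W) * n + (n div L + 1) * (batch_time + 5))"
proof -
  let ?I = "\<lambda>j s'. G (of_bool (found j)) s' \<and> parsed W s' \<and> alphas n 0 s'"
  have loop: "ok xs M (For vj (Var vn \<^bold>/ Var vL \<^bold>+ Lit 1) body_batch) s0 (?I (n div L + 1))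
      (sizeE (Var vn \<^bold>/ Var vL \<^bold>+ Lit 1) + 3 + (n div L + 1) * (batch_time + 5))"
    if inv: "G 0 s0 \<and> parsed W s0 \<and> alphas n 0 s0" for s0
  proof (rule ok_for[where I = ?I])
    have g: "vars s0 vL = L" "vars s0 vn = n" using inv by (simp_all add: G_def)
    have "n div L \<le> n" by simp
    then have M: "n div L + 1 < M" "1 < M" using small_less_M(3)[of n] n2 by linarith+
    show "safeE xs M (Var vn \<^bold>/ Var vL \<^bold>+ Lit 1) s0" using g M by simp
    show "eval xs (Var vn \<^bold>/ Var vL \<^bold>+ Lit 1) s0 = n div L + 1" using g by simp
    show "n div L + 1 < M" by fact
    show "?I 0 s0" using inv by (simp add: found_def)
  next
    fix j s1 assume "j < n div L + 1" "?I j s1"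
    then show "ok xs M body_batch (set_var vj j s1) (?I (Suc j)) batch_time"
      by (intro body_batch_ok) auto
  qed
  show ?thesis
    unfolding prog_def
    apply (rule ok_weaken[OF ok_seq[OF prog_init_ok ok_seq[OF prog_parse_ok
      ok_seq[OF prog_alpha_ok loop]]]])
         apply assumption
        apply (erule conjunct1)
       apply (erule conjunct2)
      apply assumption
     apply (simp add: G_def found_all[simplified])
    apply simp
    done
qed

section \<open>Running time\<close>

definition run_time :: nat where
  "run_time = 100 + 30 * n + 205 * W + (10 + 205 * W) * n + (n div L + 1) * (batch_time + 5)"

lemma square_exp_le: "(2 ^ (L div 4)) ^ 2 \<le> n"
proof -
  have "(2 ^ (L div 4)) ^ 2 = (2::nat) ^ (2 * (L div 4))"
    by (simp add: power_mult[symmetric] mult.commute)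
  also have "\<dots> \<le> 2 ^ L" by (intro power_increasing) auto
  finally show ?thesis using L_le by (rule order_trans)
qed

lemma L_le_exp: "L \<le> 4 * 2 ^ (L div 4)"
proof -
  have "L < 4 * (L div 4 + 1)" by presburger
  moreover have "L div 4 + 1 \<le> 2 ^ (L div 4)"
    unfolding Suc_eq_plus1[symmetric] Suc_le_eq by (rule less_exp)
  ultimately show ?thesis by linarith
qed

lemma L_square_le: "L * L \<le> 16 * n"
proof -
  have "L * L \<le> (4 * 2 ^ (L div 4)) * (4 * 2 ^ (L div 4))" by (intro mult_le_mono L_le_exp)
  also have "\<dots> = 16 * (2 ^ (L div 4)) ^ 2" by (simp add: power2_eq_square)
  finally show ?thesis using square_exp_le by simp
qed

text \<open>What the division by 4 in \<open>s\<close> is for: \<open>n / L\<close> batches with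
  tables in time O(m * (D + L)) stay within the bound if \<open>D * L\<close> and
  \<open>L * L\<close> are O(n). Both \<open>D\<close> and \<open>L\<close> are at most
  \<open>4 * 2 ^ (L div 4)\<close>, whose square is at most \<open>16 * n\<close>.\<close>

lemma D_L_le: "D * L \<le> 16 * n"
proof -
  have D: "D = 4 * 2 ^ (L div 4)" by (simp add: D_def s_def)
  have "D * L \<le> (4 * 2 ^ (L div 4)) * (4 * 2 ^ (L div 4))"
    unfolding D by (intro mult_le_mono L_le_exp order_refl)
  also have "\<dots> = 16 * (2 ^ (L div 4)) ^ 2" by (simp add: power2_eq_square)
  finally show ?thesis using square_exp_le by simp
qed

text \<open>The constant is 4 * 2 * 4, from \<open>L \<le> 4 * (s + 1)\<close>, the potential bound
  \<open>2 * W\<close> and \<open>W < 4 * m\<close>.\<close>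

lemma events_le: "length (evs W) * L \<le> 32 * m"
proof -
  have "L \<le> 4 * (s + 1)" unfolding s_def by presburger
  then have "length (evs W) * L \<le> length (evs W) * (4 * (s + 1))" by (intro mult_le_mono2)
  moreover have "(s + 1) * length (evs W) \<le> 2 * W" using evs_potential[of W] by simp
  ultimately show ?thesis using W_bounds(1) by (simp add: algebra_simps)
qed

text \<open>The first summand pays for tables and cut tokens, the second mainly for the constant
  overhead of the \<open>n\<close> queries; over all batches the latter turns into n^2 / log
  n.\<close>

lemma batch_time_le: "L * (batch_time + 5) \<le> 40000 * (n * m) + 400 * (n * L)"
proof -
  have L1: "L \<le> L * L" "L \<le> n * L" using L_pos n2 by simp_all
  \<comment> \<open>Each of \<open>L\<close>, \<open>D * L\<close> and \<open>L * L\<close> is at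
    most \<open>16 * n\<close>, and 16 * (205 + 85 + 45) is below 6000.\<close>
  have "W * (L * (205 + 85 * D + 45 * L)) \<le> 4 * m * (6000 * n)"
  proof (rule mult_le_mono)
    have "L * (205 + 85 * D + 45 * L) = 205 * L + 85 * (D * L) + 45 * (L * L)"
      by (simp add: algebra_simps)
    then show "L * (205 + 85 * D + 45 * L) \<le> 6000 * n"
      using L_square_le D_L_le L1 by linarith
  qed (use W_bounds in simp)
  moreover have "n * (length (evs W) * L) \<le> n * (32 * m)" by (intro mult_le_mono2 events_le)
  moreover have "L * (batch_time + 5) = 105 * L + W * (L * (205 + 85 * D + 45 * L)) + 205 * (n * L)
      + 305 * (n * (length (evs W) * L))"
    by (simp add: batch_time_def algebra_simps)
  moreover have "4 * m * (6000 * n) = 24000 * (n * m)" "n * (32 * m) = 32 * (n * m)" by simp_all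
  ultimately show ?thesis using L1 by linarith
qed

text \<open>The factor \<open>L * L\<close> avoids divisions of natural numbers. One
  \<open>L\<close> is absorbed by the number of batches,
  \<open>(n div L + 1) * L \<le> 2 * n\<close>, and the other by \<open>batch_time_le\<close>; the
  preprocessing is O(n m), where \<open>L_square_le\<close> suffices.\<close>

lemma run_time_le: "L * L * run_time \<le> 200000 * (n * n * m + n * n * L)"
proof -
  have W: "W \<le> 4 * m" using W_bounds by simp
  have "W * n \<le> 4 * m * n" using W by (intro mult_le_mono1)
  moreover have "(10 + 205 * W) * n = 10 * n + 205 * (W * n)" "4 * m * n = 4 * (n * m)"
    by (simp_all add: algebra_simps)
  ultimately have "100 + 30 * n + 205 * W + (10 + 205 * W) * n \<le> 2000 * (n * m)"
    using W nm by linarith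
  then have "L * L * (100 + 30 * n + 205 * W + (10 + 205 * W) * n) \<le> 16 * n * (2000 * (n * m))"
    by (intro mult_le_mono L_square_le)
  moreover have "L * L * ((n div L + 1) * (batch_time + 5)) \<le>
      2 * n * (40000 * (n * m) + 400 * (n * L))"
  proof -
    have "n div L * L + L \<le> 2 * n" using L_less_n div_times_less_eq_dividend[of n L] by linarith
    then have "(n div L + 1) * L \<le> 2 * n" by simp
    then have "((n div L + 1) * L) * (L * (batch_time + 5)) \<le>
        2 * n * (40000 * (n * m) + 400 * (n * L))"
      by (rule mult_le_mono[OF _ batch_time_le])
    then show ?thesis by (simp only: ac_simps)
  qed
  moreover have "L * L * run_time = L * L * (100 + 30 * n + 205 * W + (10 + 205 * W) * n) +
      L * L * ((n div L + 1) * (batch_time + 5))"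
    unfolding run_time_def by (rule distrib_left)
  moreover have "16 * n * (2000 * (n * m)) = 32000 * (n * n * m)"
    "2 * n * (40000 * (n * m) + 400 * (n * L)) = 80000 * (n * n * m) + 800 * (n * n * L)"
    "200000 * (n * n * m + n * n * L) = 200000 * (n * n * m) + 200000 * (n * n * L)"
    by (simp_all add: algebra_simps)
  ultimately show ?thesis by linarith
qed

lemma run_time_real_le:
  "real run_time \<le> 800000 * (real n ^ 2 * real m / log 2 (real n) ^ 2 + real n ^ 2 / log 2 (real n))"
proof -
  let ?g = "log 2 (real n)"
  have "?g < real (Suc L)"
    by (rule log2_of_power_less) (use L_less n2 in simp_all)
  moreover have "1 \<le> real L" using L_pos by simp
  \<comment> \<open>Rounding the logarithm down costs a factor 2, which is squared in the first
    summand; hence 800000 = 4 * 200000.\<close>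
  ultimately have g2: "?g \<le> 2 * real L" by simp
  have "log 2 2 \<le> ?g" using n2 by (subst log_le_cancel_iff) auto
  then have g1: "0 < ?g" by simp
  have L0: "0 < real L" using L_pos by simp
  have "real (L * L * run_time) \<le> real (200000 * (n * n * m + n * n * L))"
    using run_time_le of_nat_mono by blast
  then have "real run_time * real L ^ 2 \<le> 200000 * (real n ^ 2 * real m + real n ^ 2 * real L)"
    by (simp add: power2_eq_square algebra_simps)
  then have "real run_time \<le> 200000 * (real n ^ 2 * real m + real n ^ 2 * real L) / real L ^ 2"
    using L0 by (simp add: pos_le_divide_eq)
  also have "\<dots> = 200000 * (real n ^ 2 * real m / real L ^ 2 + real n ^ 2 / real L)"
    using L0 by (simp add: field_simps power2_eq_square)
  also have "\<dots> \<le> 200000 * (real n ^ 2 * real m / (?g / 2) ^ 2 + real n ^ 2 / (?g / 2))"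
    using g1 g2 L0
    by (intro mult_left_mono add_mono divide_left_mono power_mono mult_pos_pos) auto
  also have "\<dots> \<le> 800000 * (real n ^ 2 * real m / ?g ^ 2 + real n ^ 2 / ?g)"
    using g1 by (simp add: field_simps power_divide)
  finally show ?thesis .
qed

end

section \<open>From encoded inputs to the abstract instance\<close>

lemma nth_concat_rows:
  assumes "\<forall>r \<in> set rs. length r = m" "i < length rs" "j < m"
  shows "concat rs ! (i * m + j) = rs ! i ! j"
  using assms
proof (induction rs arbitrary: i)
  case (Cons r rs)
  then show ?case by (cases i) (auto simp: nth_append)
qed simp

lemma length_concat_rows: "\<forall>r \<in> set rs. length r = m \<Longrightarrow> length (concat rs) = length rs * m"
  by (induction rs) auto

definition leaf_val :: "bool list \<Rightarrow> bool list \<Rightarrow> nat \<Rightarrow> bool" where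
  "leaf_val a b c = ((if is_X c then a ! coord c else b ! coord c) \<noteq> odd c)"

lemma leaf_tokens:
  "coord (4 * k + 2) = k" "coord (4 * k + 3) = k" "coord (4 * k + 4) = k" "coord (4 * k + 5) = k"
  "is_X (4 * k + 2)" "is_X (4 * k + 3)" "\<not> is_X (4 * k + 4)" "\<not> is_X (4 * k + 5)"
proof -
  have d: "(4 * k + r) div 4 = k" "(4 * k + r) mod 4 = r" if "r < 4" for r :: nat
    using that by simp_all
  have e: "4 * k + 2 - 2 = 4 * k + 0" "4 * k + 3 - 2 = 4 * k + 1" "4 * k + 4 - 2 = 4 * k + 2"
    "4 * k + 5 - 2 = 4 * k + 3" by simp_all
  show "coord (4 * k + 2) = k" "coord (4 * k + 3) = k" "coord (4 * k + 4) = k"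
    "coord (4 * k + 5) = k"
    "is_X (4 * k + 2)" "is_X (4 * k + 3)" "\<not> is_X (4 * k + 4)" "\<not> is_X (4 * k + 5)"
    unfolding coord_def is_X_def e by (subst d; simp)+
qed

lemma encode_leaf:
  "2 * encode_var (X k) + 2 = 4 * k + 2" "2 * encode_var (X k) + 3 = 4 * k + 3"
  "2 * encode_var (Y k) + 2 = 4 * k + 4" "2 * encode_var (Y k) + 3 = 4 * k + 5"
  by simp_all

lemma leaf_val_encode:
  "leaf_val a b (2 * encode_var v + 2) = eval_var a b v"
  "leaf_val a b (2 * encode_var v + 3) = (\<not> eval_var a b v)"
  unfolding leaf_val_def
  by (cases v; simp only: encode_leaf leaf_tokens eval_var.simps; simp)+

theorem theoremB4:
  fixes \<kappa> :: real
  shows "\<exists>(P :: instr list) (K :: nat) (c :: real). K \<ge> 1 \<and>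
    (\<forall>(w :: nat) (n :: nat) (m :: nat) (F :: formula) (as :: bool list list) (bs :: bool list list).
       n \<ge> 2 \<longrightarrow>
       formula_pair_instance n m F as bs \<longrightarrow>
       admissible_word_size \<kappa> K n (encode_instance n m F as bs) w \<longrightarrow>
       decides_within w P (encode_instance n m F as bs)
         (formula_pair F (set as) (set bs))
         (c * (real n ^ 2 * real m / log 2 (real n) ^ 2 + real n ^ 2 / log 2 (real n))))"
proof (intro exI conjI allI impI)
  show "(1::nat) \<le> 600" by simp
next
  fix w n m F as bs
  assume n2: "2 \<le> n" and inst: "formula_pair_instance n m F as bs"
    and adm: "admissible_word_size \<kappa> 600 n (encode_instance n m F as bs) w"
  define xs where "xs = encode_instance n m F as bs"
  define tk where "tk = (\<lambda>t. xs ! (t + 2))"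
  have each: "each_var_once m F" and as: "length as = n" "\<forall>a \<in> set as. length a = m"
    and bs: "length bs = n" "\<forall>b \<in> set bs. length b = m"
    using inst by (auto simp: formula_pair_instance_def)
  have vars: "v \<in> set (leaf_vars F) \<Longrightarrow> coord (2 * encode_var v + 2) < m \<and> coord (2 * encode_var v + 3) < m" for v
  proof -
    assume "v \<in> set (leaf_vars F)"
    then obtain i where "i < m" "v = X i \<or> v = Y i" using each by (auto simp: each_var_once_def)
    then show ?thesis by (auto simp only: encode_leaf leaf_tokens)
  qed
  have lenF1: "length (encode_formula F) + 1 = 4 * m"
    using length_encode_formula[of F] length_leaf_vars[OF each] by simp
  \<comment> \<open>A formula has at least one token, which is impossible for
    \<open>m = 0\<close>.\<close>
  have m1: "1 \<le> m" using lenF1 by (cases m) auto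
  have lenF: "length (encode_formula F) = 4 * m - 1" using lenF1 by simp
  have rows: "length (concat as) = n * m" "length (concat bs) = n * m"
    using length_concat_rows[OF as(2)] length_concat_rows[OF bs(2)] as(1) bs(1) by simp_all
  then have lenA: "length (encode_vectors as) = n * m" and lenB: "length (encode_vectors bs) = n * m"
    by (simp_all add: encode_vectors_def)
  have tkF: "tk t = encode_formula F ! t" if "t < length (encode_formula F)" for t
    using that by (simp add: tk_def xs_def encode_instance_def nth_append)
  have parse: "(\<forall>t. t < 4 * m - 1 \<longrightarrow> tk t < 2 \<longrightarrow> wf_tokens tk t) \<and>
      val tk (leaf_val a b) (4 * m - 1 - 1) = eval_formula a b F" for a b
  proof -
    have "0 < 4 * m - 1 \<and> stk tk (4 * m - 1) = (4 * m - 1 - 1) # stk tk 0 \<and>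
      (\<forall>t. 0 \<le> t \<longrightarrow> t < 4 * m - 1 \<longrightarrow> tk t < 2 \<longrightarrow> wf_tokens tk t) \<and>
      val tk (leaf_val a b) (4 * m - 1 - 1) = eval_formula a b F"
    proof (rule parse)
      show "tk (0 + i) = encode_formula F ! i" if "i < length (encode_formula F)" for i
        using tkF[OF that] by simp
    qed (rule leaf_val_encode, rule leaf_val_encode, simp only: lenF add_0)
    then show ?thesis by simp
  qed
  obtain L where L: "2 ^ L \<le> n" "n < 2 * 2 ^ L"
    using ex_power_ivl1[of 2 n] n2 by auto
  have row: "i * m + j < n * m" if "i < n" "j < m" for i j
    using that mult_le_mono1[of "i + 1" n m] by simp
  have pre: "xs ! (4 * m + 1 + i) = (encode_vectors as @ encode_vectors bs) ! i" for i
  proof -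
    have "xs = ([n, m] @ encode_formula F) @ encode_vectors as @ encode_vectors bs"
      by (simp add: xs_def encode_instance_def)
    moreover have "length ([n, m] @ encode_formula F) = 4 * m + 1" using lenF1 by simp
    ultimately show ?thesis by (metis nth_append_length_plus)
  qed
  interpret inst xs n m L tk "\<lambda>i j. as ! i ! j" "\<lambda>i j. bs ! i ! j"
  proof
    show "xs ! 0 = n" "xs ! 1 = m" by (simp_all add: xs_def encode_instance_def)
    show "length xs = 4 * m + 1 + 2 * n * m"
      using lenF1 lenA lenB by (simp add: xs_def encode_instance_def)
    show "xs ! (4 * m + 1 + i * m + j) = of_bool (as ! i ! j)" if ij: "i < n" "j < m" for i j
    proof -
      have "xs ! (4 * m + 1 + i * m + j) = encode_vectors as ! (i * m + j)"
        using pre[of "i * m + j"] row[OF ij] lenA by (simp add: nth_append add.assoc)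
      then show ?thesis
        using row[OF ij] ij as by (simp add: encode_vectors_def nth_concat_rows rows)
    qed
    show "xs ! (4 * m + 1 + n * m + i * m + j) = of_bool (bs ! i ! j)" if ij: "i < n" "j < m" for i j
    proof -
      have "xs ! (4 * m + 1 + n * m + i * m + j) = encode_vectors bs ! (i * m + j)"
        using pre[of "n * m + (i * m + j)"] lenA by (simp add: nth_append add.assoc)
      then show ?thesis
        using row[OF ij] ij bs by (simp add: encode_vectors_def nth_concat_rows rows)
    qed
    show "coord (tk t) < m" if t: "t < 4 * m - 1" "2 \<le> tk t" for t
    proof -
      have "tk t \<in> set (encode_formula F)" using t tkF lenF by simp
      then obtain v where "v \<in> set (leaf_vars F)"
        "tk t = 2 * encode_var v + 2 \<or> tk t = 2 * encode_var v + 3"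
        using encode_formula_leaf t(2) by blast
      then show ?thesis using vars[of v] by metis
    qed
    show "wf_tokens tk t" if "t < 4 * m - 1" "tk t < 2" for t
      using parse that by blast
  qed (use n2 m1 L in \<open>auto simp: tk_def\<close>)
  have "root i j = eval_formula (as ! i) (bs ! j) F" for i j
  proof -
    have "lv i j = leaf_val (as ! i) (bs ! j)" by (auto simp: lv_def leaf_val_def fun_eq_iff)
    then show ?thesis using parse[of "as ! i" "bs ! j"] by (simp add: root_def W_def)
  qed
  moreover have "(\<exists>a \<in> set rs. Q a) \<longleftrightarrow> (\<exists>i < length rs. Q (rs ! i))"
    for Q and rs :: "bool list list" by (metis in_set_conv_nth)
  ultimately have answer:
    "(\<exists>i < n. \<exists>j < n. root i j) \<longleftrightarrow> formula_pair F (set as) (set bs)"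
    using as(1) bs(1) by (simp add: formula_pair_def)
  show "decides_within w (compC 0 30 prog) (encode_instance n m F as bs)
      (formula_pair F (set as) (set bs))
      (800000 * (real n ^ 2 * real m / log 2 (real n) ^ 2 + real n ^ 2 / log 2 (real n)))"
    unfolding xs_def[symmetric]
  proof (rule compC_decides[where M = M])
    have "600 * length xs \<le> 2 ^ w" using adm by (simp add: admissible_word_size_def xs_def)
    \<comment> \<open>The origin of 600: the 16 arrays take about \<open>1024 * (n * m)\<close>
      words, and \<open>2 * n * m < length xs\<close> makes this less than
      \<open>512 * length xs\<close>; the rest covers the input itself and the rounding.\<close>
    moreover have "num_arrays * (M + 1) + length xs < 600 * length xs"
      unfolding length_xs num_arrays_def M_def mult.assoc using m1 by simp
    ultimately show "num_arrays * (M + 1) + length xs < 2 ^ w" by (rule less_le_trans[rotated])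
    show "well_formed 30 prog" by (rule well_formed_prog)
    show "safe xs M prog \<lparr>vars = \<lambda>_. 0, arr = \<lambda>_ _. 0\<rparr>"
      using prog_ok by (simp add: ok_def)
    show "vars (exec xs prog \<lparr>vars = \<lambda>_. 0, arr = \<lambda>_ _. 0\<rparr>) 0 =
        (if formula_pair F (set as) (set bs) then 1 else 0)"
      using prog_ok answer by (simp add: ok_def)
    have "cost xs prog \<lparr>vars = \<lambda>_. 0, arr = \<lambda>_ _. 0\<rparr> \<le> run_time"
      using prog_ok by (simp add: ok_def run_time_def)
    then show "real (cost xs prog \<lparr>vars = \<lambda>_. 0, arr = \<lambda>_ _. 0\<rparr>) \<le>
        800000 * (real n ^ 2 * real m / log 2 (real n) ^ 2 + real n ^ 2 / log 2 (real n))"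
      using run_time_real_le by linarith
  qed simp
qed

end
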